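(* There exist absolute constants $c, C>0$ such that for every positive integer $N$, \[ c N^{10} \le \mathfrak{C}_3(N) \le C N^{10}. \]
   Context: For positive integers $d,N$, let $\mathrm{Mat}_d(\mathbb{Z},N)$ denote the set of $d\times d$ matrices with all entries in $[-N,N]\cap\mathbb{Z}$, and let $\mathfrak{C}_d(N)$ be the number of pairs $(A,B)\in \mathrm{Mat}_d(\mathbb{Z},N)^2$ with $AB=BA$. *)

theory Defs
  imports "HOL-Analysis.Analysis"
begin

definition bounded_int_mats :: "nat \<Rightarrow> (int ^ 'n ^ 'n) set" where
  "bounded_int_mats N = {A. \<forall>i j. \<bar>A $ i $ j\<bar> \<le> int N}"

definition commuting_count :: "nat \<Rightarrow> ('n::finite) itself \<Rightarrow> nat" where
  "commuting_count N (_ :: 'n itself) =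
     card {(A, B). A \<in> (bounded_int_mats N :: (int ^ 'n ^ 'n) set) \<and>
                   B \<in> bounded_int_mats N \<and> A ** B = B ** A}"

end

theory Submission
  imports Defs
begin

text \<open>
  The pairs \<open>(A, c I)\<close> give the lower bound. For the upper bound work modulo scalar matrices, where
  \<open>O(M\<^sup>8)\<close> commuting pairs of height at most \<open>M\<close> are to be found. If \<open>A\<close> is nonscalar and nonderogatory,
  its centralizer modulo scalars is a lattice of rank two; if \<open>P\<close> is a shortest nonzero vector of it,
  then a packing argument bounds the number of its points of height at most \<open>M\<close> by
  \<open>(6M / height P)\<^sup>2\<close>. When \<open>P\<close> is itself nonderogatory, it has the same centralizer as \<open>A\<close>, so the
  pairs belonging to \<open>P\<close> number \<open>O((M / height P)\<^sup>4)\<close>, and summing over the points \<open>P\<close> of an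
  8-dimensional lattice gives \<open>O(M\<^sup>8)\<close>.

  A derogatory nonscalar matrix has the form \<open>l I + u v\<^sup>T\<close> with \<open>u\<close> primitive. It is determined modulo
  scalars by \<open>u\<close> and \<open>v\<close>, its height is comparable to \<open>|u| |v|\<close>, and it commutes with only \<open>O(M\<^sup>4)\<close>
  matrices of height at most \<open>M\<close> modulo scalars; so the pairs where \<open>A\<close> or \<open>P\<close> is derogatory are
  controlled by the square of \<open>\<Sum> |u|\<^sup>-\<^sup>2 = O(M)\<close> over nonzero \<open>u \<in> \<int>\<^sup>3\<close> with \<open>|u| \<le> 2M\<close>.
\<close>

section \<open>Integer linear algebra\<close>

text \<open>Fraction-free Gaussian elimination, one equation at a time: coefficients are scaled by
  the pivot \<open>a k j\<close> rather than divided by it, so everything stays integral.\<close>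

lemma nontrivial_integer_relation:
  fixes a :: "'i \<Rightarrow> 'j \<Rightarrow> int"
  assumes "finite J" "finite I" "card J < card I"
  shows "\<exists>c. (\<exists>i\<in>I. c i \<noteq> 0) \<and> (\<forall>j\<in>J. (\<Sum>i\<in>I. c i * a i j) = 0)"
  using assms
proof (induction J arbitrary: I a rule: finite_induct)
  case empty
  then obtain i where "i \<in> I" by fastforce
  then show ?case by (intro exI[of _ "\<lambda>_. 1"]) auto
next
  case (insert j J)
  show ?case
  proof (cases "\<forall>i\<in>I. a i j = 0")
    case True
    have "card J < card I" using insert by simp
    from insert.IH[OF \<open>finite I\<close> this, of a] True show ?thesis by auto
  next
    case False
    then obtain k where k: "k \<in> I" "a k j \<noteq> 0" by auto
    define b where "b i l = a k j * a i l - a i j * a k l" for i l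
    have "finite (I - {k})" "card J < card (I - {k})" using insert k by auto
    from insert.IH[OF this, of b] obtain c where
      c: "\<exists>i\<in>I - {k}. c i \<noteq> 0" "\<forall>l\<in>J. (\<Sum>i\<in>I - {k}. c i * b i l) = 0" by auto
    \<comment> \<open>The coefficient of the eliminated index \<open>k\<close> is forced by equation
      \<open>j\<close>; all others are scaled by the nonzero pivot, so the relation remains
      nontrivial.\<close>
    define d where "d i = (if i = k then - (\<Sum>i\<in>I - {k}. c i * a i j) else a k j * c i)" for i
    have split: "(\<Sum>i\<in>I. d i * a i l) = - (\<Sum>i\<in>I - {k}. c i * a i j) * a k l
        + (\<Sum>i\<in>I - {k}. a k j * c i * a i l)" for l
      by (subst sum.remove[OF \<open>finite I\<close> \<open>k \<in> I\<close>]) (auto simp: d_def intro!: sum.cong)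
    have "(\<Sum>i\<in>I. d i * a i l) = (\<Sum>i\<in>I - {k}. c i * b i l)" for l
      unfolding split b_def
      by (simp add: algebra_simps sum_subtractf sum_distrib_left sum_distrib_right sum_negf)
    moreover have "(\<Sum>i\<in>I. d i * a i j) = 0"
      unfolding split by (simp add: algebra_simps sum_distrib_left)
    moreover have "\<exists>i\<in>I. d i \<noteq> 0" using c(1) k by (auto simp: d_def)
    ultimately show ?thesis using c(2) by (intro exI[of _ d]) auto
  qed
qed

text \<open>Rational root theorem: \<open>m / g\<close> is a root of the monic polynomial X^2 + t X
  - s, hence an integer.\<close>

lemma monic_quadratic_root_dvd:
  fixes g m s t :: int
  assumes "m\<^sup>2 + t * g * m = s * g\<^sup>2" "g \<noteq> 0"
  shows "g dvd m"
proof -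
  obtain g' m' where *: "g = g' * gcd g m" "m = m' * gcd g m" "coprime g' m'"
    using assms(2) gcd_coprime_exists[of g m] by auto
  have "gcd g m \<noteq> 0" using assms by auto
  moreover have "(gcd g m)\<^sup>2 * (m'\<^sup>2 + t * g' * m') = (gcd g m)\<^sup>2 * (s * g'\<^sup>2)"
    using assms(1) by (subst (asm) *(1), subst (asm) (2) *(2), subst (asm) *(1), subst (asm) *(2))
      (simp add: power2_eq_square algebra_simps)
  ultimately have "m'\<^sup>2 + t * g' * m' = s * g'\<^sup>2" using assms(2) by auto
  then have "m'\<^sup>2 = g' * (s * g' - t * m')" by (simp add: power2_eq_square algebra_simps)
  then have "g' dvd m'\<^sup>2" by simp
  then have "is_unit g'" using *(3) 
    by (metis coprime_common_divisor coprime_power_right_iff dvd_refl)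
  then show ?thesis using *(1,2) by (metis dvd_refl dvd_triv_right mult_unit_dvd_iff' )
qed

section \<open>Cyclic vectors and the centralizer modulo scalars\<close>

text \<open>The determinant with rows \<open>x\<close>, \<open>y\<close>, \<open>z\<close> and
  columns in the order \<open>i\<close>, \<open>j\<close>, \<open>k\<close>. With the order as a
  parameter, one computation serves for every permutation of the coordinates.\<close>

definition det3 :: "'n \<Rightarrow> 'n \<Rightarrow> 'n \<Rightarrow> int ^ 'n \<Rightarrow> int ^ 'n \<Rightarrow> int ^ 'n \<Rightarrow> int" where
  "det3 i j k x y z = x $ i * (y $ j * z $ k - y $ k * z $ j) - x $ j * (y $ i * z $ k - y $ k * z $ i)
     + x $ k * (y $ i * z $ j - y $ j * z $ i)"

lemma UNIV_3_distinct:
  fixes i j k :: 3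
  assumes "distinct [i, j, k]"
  shows "UNIV = {i, j, k}"
proof -
  have "card {i, j, k} = CARD(3)" using assms by simp
  then show ?thesis by (metis card_subset_eq finite subset_UNIV)
qed

lemma sum_3_distinct:
  fixes i j k :: 3 and f :: "3 \<Rightarrow> 'a::comm_monoid_add"
  assumes "distinct [i, j, k]"
  shows "sum f UNIV = f i + f j + f k"
  using assms by (simp add: UNIV_3_distinct[OF assms] add.assoc)

text \<open>Cramer's rule: each entry of \<open>d\<close> times the determinant is a combination of
  the three vanishing products.\<close>

lemma orthogonal_to_basis_eq_0:
  fixes d x y z :: "int ^ 3"
  assumes ijk: "distinct [i, j, k]" and "det3 i j k x y z \<noteq> 0"
    and "(\<Sum>r\<in>UNIV. d $ r * x $ r) = 0" "(\<Sum>r\<in>UNIV. d $ r * y $ r) = 0" "(\<Sum>r\<in>UNIV. d $ r * z $ r) = 0"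
  shows "d = 0"
proof -
  note e = assms(3-5)[unfolded sum_3_distinct[OF ijk]]
  have "d $ i * det3 i j k x y z = 0" "d $ j * det3 i j k x y z = 0" "d $ k * det3 i j k x y z = 0"
    unfolding det3_def using e by algebra+
  then have "d $ i = 0" "d $ j = 0" "d $ k = 0" using assms(2) by auto
  then have "d $ r = 0" for r using UNIV_3_distinct[OF ijk] by (metis UNIV_I insertE singletonD)
  then show ?thesis by (simp add: vec_eq_iff)
qed

text \<open>The centralizer modulo scalar matrices; a class is represented by its member whose entry
  \<open>(3, 3)\<close> is zero.\<close>

definition reduced_centralizer :: "int ^ 3 ^ 3 \<Rightarrow> (int ^ 3 ^ 3) set" where
  "reduced_centralizer A = {X. X $ 3 $ 3 = 0 \<and> A ** X = X ** A}"

definition dependent3 :: "int ^ 3 ^ 3 \<Rightarrow> int ^ 3 ^ 3 \<Rightarrow> int ^ 3 ^ 3 \<Rightarrow> bool" where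
  "dependent3 X Y Z \<longleftrightarrow> (\<exists>\<alpha> \<beta> \<gamma>. (\<alpha> \<noteq> 0 \<or> \<beta> \<noteq> 0 \<or> \<gamma> \<noteq> 0) \<and>
     (\<forall>i j. \<alpha> * X $ i $ j + \<beta> * Y $ i $ j + \<gamma> * Z $ i $ j = 0))"

text \<open>A matrix that commutes with \<open>A\<close> and kills \<open>w\<close> also kills the
  images of \<open>w\<close> under A and A^2, so it is zero. Evaluation at \<open>w\<close> thus
  embeds the centralizer in Z^3, where the images of the four members \<open>X\<close>,
  \<open>Y\<close>, \<open>Z\<close> and the identity are dependent.\<close>

lemma cyclic_vector_dependent3:
  fixes A X Y Z :: "int ^ 3 ^ 3" and w :: "int ^ 3"
  assumes ijk: "distinct [i, j, k]" and w: "det3 i j k w (A *v w) (A *v (A *v w)) \<noteq> 0"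
    and "X \<in> reduced_centralizer A" "Y \<in> reduced_centralizer A" "Z \<in> reduced_centralizer A"
  shows "dependent3 X Y Z"
proof -
  define V where "V = (\<lambda>n::nat. [X, Y, Z, mat 1] ! n)"
  obtain c where c: "\<exists>n\<in>{..<4}. c n \<noteq> 0" "\<And>r. (\<Sum>n<4. c n * (V n *v w) $ r) = 0"
    using nontrivial_integer_relation[of "UNIV :: 3 set" "{..<4::nat}" "\<lambda>n r. (V n *v w) $ r"] by auto
  define D where "D = (\<chi> r s. c 0 * X $ r $ s + c 1 * Y $ r $ s + c 2 * Z $ r $ s + c 3 * (mat 1 :: int ^ 3 ^ 3) $ r $ s)"
  have sum4: "(\<Sum>n<4. f n) = f 0 + f 1 + f 2 + (f 3 :: int)" for f :: "nat \<Rightarrow> int"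
    by (simp add: eval_nat_numeral)
  have Dw: "D *v w = 0"
    unfolding vec_eq_iff using c(2)
    by (simp add: sum4 V_def D_def matrix_vector_mult_def sum_distrib_left sum.distrib algebra_simps numeral_3_eq_3)
  have comm: "A ** X = X ** A" "A ** Y = Y ** A" "A ** Z = Z ** A"
    using assms(3-5) by (auto simp: reduced_centralizer_def)
  have "(A ** D) $ r $ s = c 0 * (A ** X) $ r $ s + c 1 * (A ** Y) $ r $ s + c 2 * (A ** Z) $ r $ s + c 3 * (A ** mat 1) $ r $ s" for r s
    unfolding matrix_matrix_mult_def D_def by (simp add: sum_distrib_left sum.distrib algebra_simps)
  moreover have "(D ** A) $ r $ s = c 0 * (X ** A) $ r $ s + c 1 * (Y ** A) $ r $ s + c 2 * (Z ** A) $ r $ s + c 3 * (mat 1 ** A) $ r $ s" for r s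
    unfolding matrix_matrix_mult_def D_def by (simp add: sum_distrib_left sum.distrib algebra_simps)
  ultimately have AD: "D ** A = A ** D" by (simp add: vec_eq_iff comm)
  have DA: "D *v (A *v x) = A *v (D *v x)" for x
    by (simp add: matrix_vector_mul_assoc AD)
  have "D $ r = 0" for r
  proof (rule orthogonal_to_basis_eq_0[OF ijk w])
    have "(D *v w) $ r = 0" "(D *v (A *v w)) $ r = 0" "(D *v (A *v (A *v w))) $ r = 0"
      by (simp_all add: DA Dw)
    then show "(\<Sum>s\<in>UNIV. D $ r $ s * w $ s) = 0" "(\<Sum>s\<in>UNIV. D $ r $ s * (A *v w) $ s) = 0"
       "(\<Sum>s\<in>UNIV. D $ r $ s * (A *v (A *v w)) $ s) = 0"
      by (simp_all add: matrix_vector_mult_def)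
  qed
  then have D0: "D $ r $ s = 0" for r s by simp
  \<comment> \<open>\<open>X\<close>, \<open>Y\<close> and \<open>Z\<close> vanish at the entry (3,
    3), so the identity has coefficient zero in the relation.\<close>
  have "c 3 = 0" using D0[of 3 3] assms(3-5) by (simp add: D_def reduced_centralizer_def mat_def)
  moreover have "{..<4::nat} = {0,1,2,3}" by auto
  ultimately have "c 0 \<noteq> 0 \<or> c 1 \<noteq> 0 \<or> c 2 \<noteq> 0" using c(1) by auto
  moreover have "c 0 * X $ r $ s + c 1 * Y $ r $ s + c 2 * Z $ r $ s = 0" for r s
    using D0[of r s] \<open>c 3 = 0\<close> by (simp add: D_def)
  ultimately show ?thesis unfolding dependent3_def by blast
qed

text \<open>The hypothesis says that \<open>det [w, Aw, A\<^sup>2w] = 0\<close> for \<open>w = (x, 0, z)\<close>. Row 3 of \<open>A - l\<close> is then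
  \<open>s\<close> times row 2, and the determinant factors through a binary quadratic form \<open>F\<close> with nonzero leading
  coefficient \<open>a21\<close>, evaluated at the first two entries of \<open>(A - l) w\<close>.\<close>

lemma no_cyclic_vector_rank_one:
  fixes a11 a12 a13 a21 a22 a23 a31 a32 a33 :: "'a :: field_char_0"
  assumes g: "a21 \<noteq> 0"
    and K: "\<And>(m::int) (n::int) x z p q r. x = of_int m \<Longrightarrow> z = of_int n \<Longrightarrow> p = a11 * x + a13 * z \<Longrightarrow>
       q = a21 * x + a23 * z \<Longrightarrow> r = a31 * x + a33 * z \<Longrightarrow>
       x * (q * (a31 * p + a32 * q + a33 * r) - r * (a21 * p + a22 * q + a23 * r))
     + z * (p * (a21 * p + a22 * q + a23 * r) - q * (a11 * p + a12 * q + a13 * r)) = 0"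
  defines "l \<equiv> a33 - a31 * a23 / a21"
  shows "a21 * a32 = a31 * (a22 - l)" "a21 * (a33 - l) = a31 * a23"
    "(a11 - l) * a23 = a21 * a13" "(a11 - l) * (a22 - l) = a21 * a12"
proof -
  define s where "s = a31 / a21"
  define a d where "a = a11 - l" and "d = a22 - l"
  have a31: "a31 = s * a21" using g by (simp add: s_def)
  have a33: "a33 = l + s * a23" using g by (simp add: l_def s_def)
  have a11: "a11 = a + l" and a22: "a22 = d + l" by (simp_all add: a_def d_def)
  \<comment> \<open>The case w = (1, 0, 0).\<close>
  have "a21 * (a21 * (a32 - s * d)) = 0"
    using K[of 1 1 0 0 a11 a21 a31] unfolding a31 a33 a11 a22 by (simp add: algebra_simps)
  then have a32: "a32 = s * d" using g by simp
  define d' b' where "d' = d + a23 * s" and "b' = a12 + a13 * s"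
  define F where "F p q = a21 * p ^ 2 + (d' - a) * p * q - b' * q ^ 2" for p q
  \<comment> \<open>The case w = (x, 0, 1). The values at x = -1, 0, 1 show that all three
    coefficients of this quadratic polynomial in x vanish.\<close>
  have F: "F (a13 + x * a) (a23 + x * a21) = 0" if "x = of_int m" for m x
    using K[of x m 1 1 "a11 * x + a13" "a21 * x + a23" "a31 * x + a33"] that
    unfolding a31 a33 a11 a22 a32 F_def d'_def b'_def by (simp add: power2_eq_square algebra_simps)
  have "2 * (a21 * (a * d' - b' * a21)) = F (a13 + 1 * a) (a23 + 1 * a21) + F (a13 + (-1) * a) (a23 + (-1) * a21) - 2 * F (a13 + 0 * a) (a23 + 0 * a21)"
    unfolding F_def by (simp add: power2_eq_square algebra_simps)
  then have b': "a * d' = b' * a21" using F[of 1 1] F[of "-1" "-1"] F[of 0 0] g by simp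
  have *: "2 * (2 * a21 * a * a13 + (d' - a) * (a * a23 + a13 * a21) - 2 * b' * a21 * a23)
      = F (a13 + 1 * a) (a23 + 1 * a21) - F (a13 + (-1) * a) (a23 + (-1) * a21)"
    unfolding F_def by (simp add: power2_eq_square algebra_simps)
  have "2 * a21 * a * a13 + (d' - a) * (a * a23 + a13 * a21) - 2 * b' * a21 * a23 = 0"
    using F[of 1 1] F[of "-1" "-1"] * by (metis diff_self mult_eq_0_iff of_int_1 of_int_minus zero_neq_numeral)
  \<comment> \<open>By \<open>b'\<close>, \<open>a21 * F p q\<close> is the product of
    \<open>a21 * p - a * q\<close> and \<open>a21 * p + d' * q\<close>. At the points considered the
    first factor is the constant \<open>a21 * a13 - a * a23\<close>, which therefore splits off from
    the two remaining coefficients.\<close>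
  then have 1: "(a + d') * (a * a23 - a13 * a21) = 0" using b' by algebra
  have "a21 * a13 ^ 2 + (d' - a) * a13 * a23 - b' * a23 ^ 2 = 0" using F[of 0 0] by (simp add: F_def)
  then have 2: "(a13 * a21 + d' * a23) * (a * a23 - a13 * a21) = 0" using b' by algebra
  have M: "a * a23 = a21 * a13"
  proof (rule ccontr)
    assume "a * a23 \<noteq> a21 * a13"
    then have "d' = - a" "a13 * a21 + d' * a23 = 0" using 1 2 by (simp_all add: add_eq_0_iff mult.commute)
    with \<open>a * a23 \<noteq> a21 * a13\<close> show False by (simp add: algebra_simps)
  qed
  show "(a11 - l) * a23 = a21 * a13" using M by (simp add: a_def)
  have "a * d = a21 * a12" using b' M unfolding d'_def b'_def by algebra
  then show "(a11 - l) * (a22 - l) = a21 * a12" by (simp add: a_def d_def)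
  show "a21 * a32 = a31 * (a22 - l)" by (simp add: a31 a32 d_def)
  show "a21 * (a33 - l) = a31 * a23" by (simp add: a31 a33)
qed

text \<open>\<open>u k\<close> divides \<open>y k * u r\<close> for every \<open>r\<close>, hence
  divides \<open>y k\<close> times the gcd of all \<open>u r\<close>, which is \<open>y k\<close>
  itself.\<close>

lemma primitive_parallel:
  fixes u y :: "'a \<Rightarrow> int"
  assumes "Gcd (range u) = 1" "u k \<noteq> 0" "\<And>r. y r * u k = u r * y k"
  shows "\<exists>c. \<forall>r. y r = c * u r"
proof -
  have "u k dvd Gcd ((*) (y k) ` range u)"
  proof (rule Gcd_greatest)
    fix x assume "x \<in> (*) (y k) ` range u"
    then obtain r where "x = y k * u r" by auto
    then have "x = y r * u k" using assms(3)[of r] by (simp add: algebra_simps)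
    then show "u k dvd x" by simp
  qed
  then have "u k dvd y k" by (simp add: Gcd_mult assms(1))
  then obtain c where "y k = u k * c" by auto
  then have "y r = c * u r" for r using assms(2) assms(3)[of r] by simp
  then show ?thesis by blast
qed

text \<open>A nonscalar \<open>3 \<times> 3\<close> matrix is derogatory iff it differs from a scalar matrix by a matrix of rank
  one. The factor \<open>u\<close> is kept primitive so that every integer vector parallel to \<open>u\<close> is an integer
  multiple of it.\<close>

definition derogatory :: "int ^ 'n ^ 'n \<Rightarrow> int ^ 'n \<Rightarrow> int ^ 'n \<Rightarrow> bool" where
  "derogatory A u v \<longleftrightarrow> Gcd (range (($) u)) = 1 \<and> v \<noteq> 0 \<and>
     (\<exists>l. \<forall>i j. A $ i $ j = u $ i * v $ j + (if i = j then l else 0))"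

text \<open>Column \<open>m\<close> of A - l, divided by the gcd of its entries, is the primitive
  vector \<open>u\<close>. The minors through the entry (k, m) make every column parallel to
  \<open>u\<close>, hence an integer multiple of it.\<close>

lemma derogatoryI:
  fixes A :: "int ^ 'n ^ 'n" and l :: int and k m :: 'n
  defines "R \<equiv> \<lambda>i j. A $ i $ j - (if i = j then l else 0)"
  assumes nz: "R k m \<noteq> 0" and minors: "\<And>i j. R i j * R k m = R i m * R k j"
  shows "\<exists>u v. derogatory A u v"
proof -
  define d where "d = Gcd (range (\<lambda>i. R i m))"
  have "d \<noteq> 0" using nz unfolding d_def by (auto simp: Gcd_0_iff)
  have "d \<ge> 0" by (simp add: d_def)
  define u where "u = (\<chi> i. R i m div d)"
  have "d dvd R i m" for i unfolding d_def by (rule Gcd_dvd) simp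
  then have u: "R i m = d * u $ i" for i by (simp add: u_def)
  have "range (\<lambda>i. R i m) = (*) d ` range (($) u)" by (auto simp: u)
  then have "d = normalize (d * Gcd (range (($) u)))" by (metis d_def Gcd_mult)
  then have "\<bar>d\<bar> * 1 = \<bar>d\<bar> * Gcd (range (($) u))" using \<open>d \<ge> 0\<close> by (simp add: abs_mult)
  then have g: "Gcd (range (($) u)) = 1" using \<open>d \<noteq> 0\<close> by simp
  have uk: "u $ k \<noteq> 0" using nz u by auto
  have "\<exists>c. \<forall>i. R i j = c * u $ i" for j
  proof (rule primitive_parallel[OF g uk])
    fix i
    have "d * (R i j * u $ k) = d * (u $ i * R k j)" using minors[of i j] by (simp add: u algebra_simps)
    then show "R i j * u $ k = u $ i * R k j" using \<open>d \<noteq> 0\<close> by simp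
  qed
  then obtain c where c: "R i j = c j * u $ i" for i j by metis
  have "c m \<noteq> 0" using nz c by auto
  then have "(\<chi> j. c j) \<noteq> 0" by (auto simp: vec_eq_iff)
  moreover have "A $ i $ j = u $ i * (\<chi> j. c j) $ j + (if i = j then l else 0)" for i j
    using c[of i j] by (simp add: R_def algebra_simps)
  ultimately show ?thesis using g unfolding derogatory_def by blast
qed

text \<open>\<open>no_cyclic_vector_rank_one\<close>, with \<open>i\<close>, \<open>j\<close>,
  \<open>k\<close> in the roles of 1, 2, 3, gives the rank-one relations for a real
  \<open>l\<close>; the point left to settle is that this \<open>l\<close> is an integer.\<close>

lemma no_cyclic_vector_derogatory:
  fixes A :: "int ^ 3 ^ 3"
  assumes ijk: "distinct [i, j, k]" and nz: "A $ j $ i \<noteq> 0"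
    and K: "\<And>w. det3 i j k w (A *v w) (A *v (A *v w)) = 0"
  shows "\<exists>u v. derogatory A u v"
proof -
  define a where "a r s = real_of_int (A $ r $ s)" for r s
  define l where "l = a k k - a k i * a j k / a j i"
  have dist: "i \<noteq> j" "i \<noteq> k" "j \<noteq> k" "j \<noteq> i" "k \<noteq> i" "k \<noteq> j" using ijk by auto
  have U: "r = i \<or> r = j \<or> r = k" for r using UNIV_3_distinct[OF ijk] by auto
  have anz: "a j i \<noteq> 0" using nz by (simp add: a_def)
  have K': "x * (q * (a k i * p + a k j * q + a k k * r) - r * (a j i * p + a j j * q + a j k * r))
     + z * (p * (a j i * p + a j j * q + a j k * r) - q * (a i i * p + a i j * q + a i k * r)) = 0"
    if "x = of_int m" "z = of_int n" "p = a i i * x + a i k * z" "q = a j i * x + a j k * z" "r = a k i * x + a k k * z" for m n x z p q r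
  proof -
    define w :: "int ^ 3" where "w = (\<chi> s. if s = i then m else if s = k then n else 0)"
    define p' q' r' where "p' = A $ i $ i * m + A $ i $ k * n" and "q' = A $ j $ i * m + A $ j $ k * n"
      and "r' = A $ k $ i * m + A $ k $ k * n"
    have w: "w $ i = m" "w $ j = 0" "w $ k = n" using dist by (auto simp: w_def)
    have mv: "(A *v y) $ s = A $ s $ i * y $ i + A $ s $ j * y $ j + A $ s $ k * y $ k" for y s
      by (simp add: matrix_vector_mult_def sum_3_distinct[OF ijk])
    have Aw: "(A *v w) $ i = p'" "(A *v w) $ j = q'" "(A *v w) $ k = r'"
      by (simp_all add: mv w p'_def q'_def r'_def)
    have "m * (q' * (A $ k $ i * p' + A $ k $ j * q' + A $ k $ k * r') - r' * (A $ j $ i * p' + A $ j $ j * q' + A $ j $ k * r'))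
     + n * (p' * (A $ j $ i * p' + A $ j $ j * q' + A $ j $ k * r') - q' * (A $ i $ i * p' + A $ i $ j * q' + A $ i $ k * r')) = 0"
      using K[of w] unfolding det3_def w mv[of "A *v w"] Aw by simp
    from arg_cong[OF this, of real_of_int] show ?thesis
      unfolding that by (simp add: a_def p'_def q'_def r'_def)
  qed
  have R: "a j i * a k j = a k i * (a j j - l)" "a j i * (a k k - l) = a k i * a j k"
    "(a i i - l) * a j k = a j i * a i k" "(a i i - l) * (a j j - l) = a j i * a i j"
    unfolding l_def
    by (rule no_cyclic_vector_rank_one(1), rule anz, rule K', assumption+)
       (rule no_cyclic_vector_rank_one(2), rule anz, rule K', assumption+,
        rule no_cyclic_vector_rank_one(3), rule anz, rule K', assumption+,
        rule no_cyclic_vector_rank_one(4), rule anz, rule K', assumption+)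
  have "a j i * ((a i i - l) * (a k k - l)) = (a i i - l) * (a j i * (a k k - l))" by simp
  also have "\<dots> = a k i * ((a i i - l) * a j k)" unfolding R(2) by simp
  also have "\<dots> = a j i * (a i k * a k i)" unfolding R(3) by simp
  finally have "a j i * ((a i i - l) * (a k k - l)) = a j i * (a i k * a k i)" .
  then have ik: "(a i i - l) * (a k k - l) = a i k * a k i" using anz by simp
  \<comment> \<open>Put q = a_kk - l, which is \<open>a k i * a j k / a j i\<close> by definition of
    \<open>l\<close>. Then \<open>ik\<close> reads q^2 + (a_ii - a_kk) q = a_ik a_ki, a monic
    quadratic over the integers, so q is an integer.\<close>
  have "(a k i * a j k) ^ 2 + (a i i - a k k) * a j i * (a k i * a j k) = a i k * a k i * a j i ^ 2"
    unfolding R(2)[symmetric] ik[symmetric] by (simp add: power2_eq_square algebra_simps)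
  then have "real_of_int ((A $ k $ i * A $ j $ k)\<^sup>2 + (A $ i $ i - A $ k $ k) * A $ j $ i * (A $ k $ i * A $ j $ k))
       = real_of_int (A $ i $ k * A $ k $ i * (A $ j $ i)\<^sup>2)"
    by (simp add: a_def)
  then have "A $ j $ i dvd A $ k $ i * A $ j $ k"
    unfolding of_int_eq_iff using nz by (rule monic_quadratic_root_dvd)
  then obtain t where "A $ k $ i * A $ j $ k = A $ j $ i * t" by auto
  then have "a k i * a j k = a j i * of_int t" unfolding a_def by (metis of_int_mult)
  then have l: "l = of_int (A $ k $ k - t)" using anz by (simp add: l_def a_def)
  define L where "L = A $ k $ k - t"
  have M: "A $ j $ i * A $ k $ j = A $ k $ i * (A $ j $ j - L)" "A $ j $ i * (A $ k $ k - L) = A $ k $ i * A $ j $ k"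
    "(A $ i $ i - L) * A $ j $ k = A $ j $ i * A $ i $ k" "(A $ i $ i - L) * (A $ j $ j - L) = A $ j $ i * A $ i $ j"
    using R unfolding a_def l L_def[symmetric] of_int_mult[symmetric] of_int_diff[symmetric] of_int_eq_iff by auto
  show ?thesis
  proof (rule derogatoryI[of A j i L])
    show "A $ j $ i - (if j = i then L else 0) \<noteq> 0" using nz dist by simp
    fix r s
    show "(A $ r $ s - (if r = s then L else 0)) * (A $ j $ i - (if j = i then L else 0))
      = (A $ r $ i - (if r = i then L else 0)) * (A $ j $ s - (if j = s then L else 0))"
      using U[of r] U[of s] M dist by (auto simp: mult.commute)
  qed
qed

text \<open>A nonzero off-diagonal entry is the previous case. For diagonal \<open>A\<close> the
  all-ones vector produces a Vandermonde determinant, so two diagonal entries agree; subtracting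
  that value leaves a single nonzero entry.\<close>

lemma derogatory_if_no_cyclic_vector:
  fixes A :: "int ^ 3 ^ 3"
  assumes "A \<noteq> mat (A $ 3 $ 3)"
    and K: "\<And>i j k w. distinct [i, j, k] \<Longrightarrow> det3 i j k w (A *v w) (A *v (A *v w)) = 0"
  shows "\<exists>u v. derogatory A u v"
proof (cases "\<exists>i j. i \<noteq> j \<and> A $ j $ i \<noteq> 0")
  case True
  then obtain i j where ij: "i \<noteq> j" "A $ j $ i \<noteq> 0" by blast
  obtain k where "k \<notin> {i, j}"
  proof -
    have "card {i, j} \<le> 2" by (simp add: card_insert_if)
    then have "{i, j} \<noteq> UNIV" by auto
    then show ?thesis using that by blast
  qed
  then show ?thesis using no_cyclic_vector_derogatory[of i j k A] ij K by auto
next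
  case False
  then have off: "A $ i $ j = 0" if "i \<noteq> j" for i j using that by metis
  define d where "d i = A $ i $ i" for i
  have mv: "(A *v y) $ i = d i * y $ i" for y i
  proof -
    have "(A *v y) $ i = (\<Sum>s\<in>UNIV. A $ i $ s * y $ s)" by (simp add: matrix_vector_mult_def)
    also have "\<dots> = (\<Sum>s\<in>UNIV. if s = i then d i * y $ i else 0)"
      by (rule sum.cong) (auto simp: d_def off)
    finally show ?thesis by simp
  qed
  have "det3 1 2 3 1 (A *v 1) (A *v (A *v 1)) = 0" by (rule K) simp
  then have "(d 2 - d 1) * (d 3 - d 1) * (d 3 - d 2) = 0"
    unfolding det3_def mv by (simp add: algebra_simps)
  then have eq: "d 1 = d 2 \<or> d 1 = d 3 \<or> d 2 = d 3" by auto
  have key: ?thesis if ijk: "distinct [i, j, k]" and d: "d i = d j" for i j k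
  proof (rule derogatoryI[of A k k "d i"])
    have U: "r = i \<or> r = j \<or> r = k" for r using UNIV_3_distinct[OF ijk] by auto
    show "A $ k $ k - (if k = k then d i else 0) \<noteq> 0"
    proof
      assume "A $ k $ k - (if k = k then d i else 0) = 0"
      then have "A $ r $ r = d i" for r using U[of r] d by (auto simp: d_def)
      then have "A = mat (A $ 3 $ 3)" by (auto simp: vec_eq_iff mat_def off)
      with assms(1) show False by simp
    qed
    fix r s
    show "(A $ r $ s - (if r = s then d i else 0)) * (A $ k $ k - (if k = k then d i else 0))
       = (A $ r $ k - (if r = k then d i else 0)) * (A $ k $ s - (if k = s then d i else 0))"
      using U[of r] U[of s] ijk d by (auto simp: d_def off)
  qed
  from eq show ?thesis using key[of 1 2 3] key[of 1 3 2] key[of 2 3 1] by auto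
qed

section \<open>Lattice points in boxes\<close>

text \<open>The sup norm is taken on functions so that vectors and matrices share it, and is a
  natural number so that points can be sorted into shells.\<close>

definition sup_abs :: "('i::finite \<Rightarrow> int) \<Rightarrow> nat" where
  "sup_abs x = Max (range (\<lambda>i. nat \<bar>x i\<bar>))"

lemma sup_abs_le_iff: "sup_abs x \<le> k \<longleftrightarrow> (\<forall>i. \<bar>x i\<bar> \<le> int k)"
  unfolding sup_abs_def by (subst Max_le_iff) (auto simp: nat_le_iff)

lemma abs_le_sup_abs: "\<bar>x i\<bar> \<le> int (sup_abs x)"
  using sup_abs_le_iff[of x "sup_abs x"] by simp

lemma sup_abs_attained: "\<exists>i. \<bar>x i\<bar> = int (sup_abs x)"
proof -
  have "sup_abs x \<in> range (\<lambda>i. nat \<bar>x i\<bar>)" unfolding sup_abs_def by (rule Max_in) auto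
  then show ?thesis by auto
qed

lemma sup_abs_eq_0_iff: "sup_abs x = 0 \<longleftrightarrow> x = (\<lambda>_. 0)"
  using sup_abs_le_iff[of x 0] by (auto simp: fun_eq_iff)

section \<open>Point counts in lattices of rank at most two\<close>

definition rank_le_2 :: "('i \<Rightarrow> int) set \<Rightarrow> bool" where
  "rank_le_2 S \<longleftrightarrow> (\<forall>x\<in>S. \<forall>y\<in>S. \<forall>z\<in>S. \<exists>a b c. (a \<noteq> 0 \<or> b \<noteq> 0 \<or> c \<noteq> 0) \<and>
     (\<forall>i. a * x i + b * y i + c * z i = 0))"

text \<open>Choosing the coordinates at which a \<open>2 \<times> 2\<close> minor is largest makes all coefficients in Cramer's
  rule at most 1.\<close>

lemma rank_le_2_dominating_coordinates:
  fixes S :: "('i::finite \<Rightarrow> int) set"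
  assumes "rank_le_2 S"
  shows "\<exists>i j. \<forall>x\<in>S. \<forall>k. \<bar>x k\<bar> \<le> \<bar>x i\<bar> + \<bar>x j\<bar>"
proof (cases "\<exists>P\<in>S. \<exists>Q\<in>S. \<exists>i j. P i * Q j - P j * Q i \<noteq> 0")
  case True
  then obtain P Q i0 j0 where PQ: "P \<in> S" "Q \<in> S" "P i0 * Q j0 - P j0 * Q i0 \<noteq> 0" by blast
  define m where "m = (\<lambda>(i,j). P i * Q j - P j * Q i)"
  obtain ij where "\<bar>m ij\<bar> = int (sup_abs m)" using sup_abs_attained by blast
  then obtain i j where ij: "\<bar>m (i,j)\<bar> = int (sup_abs m)" by (cases ij) auto
  have max: "\<bar>m kl\<bar> \<le> \<bar>m (i,j)\<bar>" for kl using abs_le_sup_abs[of m] ij by simp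
  have nz: "m (i,j) \<noteq> 0" using max[of "(i0,j0)"] PQ(3) by (auto simp: m_def)
  have "\<bar>x k\<bar> \<le> \<bar>x i\<bar> + \<bar>x j\<bar>" if x: "x \<in> S" for x k
  proof -
    obtain a b c where abc: "a \<noteq> 0 \<or> b \<noteq> 0 \<or> c \<noteq> 0" "\<And>i. a * P i + b * Q i + c * x i = 0"
      using assms[unfolded rank_le_2_def, rule_format, OF PQ(1,2) x] by auto
    have "c \<noteq> 0"
    proof
      assume "c = 0"
      then have *: "a * P i + b * Q i = 0" "a * P j + b * Q j = 0" using abc(2)[of i] abc(2)[of j] by auto
      have "a * m (i,j) = 0" "b * m (i,j) = 0" unfolding m_def using * by (simp_all, algebra, algebra)
      then show False using nz abc(1) \<open>c = 0\<close> by auto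
    qed
    moreover have "c * (x k * m (i,j)) = c * (x i * m (k,j) + x j * m (i,k))"
    proof -
      have e: "c * x k = - (a * P k + b * Q k)" "c * x i = - (a * P i + b * Q i)" "c * x j = - (a * P j + b * Q j)"
        using abc(2)[of i] abc(2)[of j] abc(2)[of k] by auto
      have "(c * x k) * m (i,j) = (c * x i) * m (k,j) + (c * x j) * m (i,k)"
        unfolding e m_def by (simp add: algebra_simps)
      then show ?thesis by (simp add: algebra_simps)
    qed
    ultimately have "x k * m (i,j) = x i * m (k,j) + x j * m (i,k)" by simp
    then have "\<bar>x k\<bar> * \<bar>m (i,j)\<bar> \<le> \<bar>x i\<bar> * \<bar>m (k,j)\<bar> + \<bar>x j\<bar> * \<bar>m (i,k)\<bar>"
      by (metis abs_mult abs_triangle_ineq)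
    also have "\<dots> \<le> \<bar>x i\<bar> * \<bar>m (i,j)\<bar> + \<bar>x j\<bar> * \<bar>m (i,j)\<bar>"
      by (intro add_mono mult_left_mono max) auto
    also have "\<dots> = (\<bar>x i\<bar> + \<bar>x j\<bar>) * \<bar>m (i,j)\<bar>" by (simp add: distrib_right)
    finally show ?thesis using nz by simp
  qed
  then show ?thesis by blast
next
  case False
  \<comment> \<open>All points are parallel, so the largest coordinate of one nonzero point
    dominates; it is used for both \<open>i\<close> and \<open>j\<close>.\<close>
  then have minor: "P i * Q j = P j * Q i" if "P \<in> S" "Q \<in> S" for P Q i j using that by auto
  show ?thesis
  proof (cases "\<exists>P\<in>S. P \<noteq> (\<lambda>_. 0)")
    case True
    then obtain P where P: "P \<in> S" "P \<noteq> (\<lambda>_. 0)" by blast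
    obtain i where i: "\<bar>P i\<bar> = int (sup_abs P)" using sup_abs_attained by blast
    have nz: "P i \<noteq> 0" using i P(2) sup_abs_eq_0_iff[of P] by auto
    have "\<bar>x k\<bar> \<le> \<bar>x i\<bar> + \<bar>x i\<bar>" if x: "x \<in> S" for x k
    proof -
      have "\<bar>x k\<bar> * \<bar>P i\<bar> = \<bar>x i\<bar> * \<bar>P k\<bar>"
        using minor[OF P(1) x, of i k] by (simp add: abs_mult[symmetric] mult.commute)
      also have "\<dots> \<le> \<bar>x i\<bar> * \<bar>P i\<bar>" using abs_le_sup_abs[of P k] i by (intro mult_left_mono) auto
      finally show ?thesis using nz by simp
    qed
    then show ?thesis by blast
  next
    case False
    then have zero: "x k = 0" if "x \<in> S" for x k using that by (metis (mono_tags))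
    have "\<bar>x k\<bar> \<le> \<bar>x i\<bar> + \<bar>x i\<bar>" if "x \<in> S" for x i k using zero[OF that, of k] by simp
    then show ?thesis by blast
  qed
qed

text \<open>Counts the cells of length \<open>h\<close> that meet the interval. The summand 2 covers
  the rounding at the lower end and the inclusion of both end cells.\<close>

lemma card_div_interval_le:
  fixes h :: int
  assumes "h > 0"
  shows "real (card ((\<lambda>x. x div h) ` {- int M..int M})) \<le> 2 * real M / real_of_int h + 2"
proof -
  have "(\<lambda>x. x div h) ` {- int M..int M} \<subseteq> {(- int M) div h..int M div h}"
    using assms by (auto intro: zdiv_mono1)
  then have "card ((\<lambda>x. x div h) ` {- int M..int M}) \<le> card {(- int M) div h..int M div h}"
    by (intro card_mono) auto
  also have "\<dots> = nat (int M div h - (- int M) div h + 1)" by simp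
  finally have "real (card ((\<lambda>x. x div h) ` {- int M..int M})) \<le> real (nat (int M div h - (- int M) div h + 1))"
    by linarith
  also have "\<dots> = real_of_int (int M div h) - real_of_int ((- int M) div h) + 1"
    using zdiv_mono1[of "- int M" "int M" h] assms by simp
  also have "\<dots> \<le> 2 * real M / real_of_int h + 2"
  proof -
    have "real_of_int (int M div h) \<le> real M / real_of_int h"
      by (metis floor_divide_of_int_eq of_int_floor_le of_int_of_nat_eq)
    moreover have "- real M / real_of_int h \<le> real_of_int ((- int M) div h) + 1"
      by (metis floor_divide_of_int_eq of_int_of_nat_eq of_int_minus real_of_int_floor_add_one_ge)
    ultimately show ?thesis by simp
  qed
  finally show ?thesis .
qed

text \<open>Two points of \<open>S\<close> in a common square cell of side \<open>(p + 1) div 2\<close> in the dominating coordinates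
  differ by a vector of norm less than \<open>p\<close>.\<close>

lemma card_rank_le_2_ball_le:
  fixes S :: "('i::finite \<Rightarrow> int) set" and M p :: nat
  assumes rank: "rank_le_2 S"
    and diff: "\<And>x y. x \<in> S \<Longrightarrow> y \<in> S \<Longrightarrow> (\<lambda>i. x i - y i) \<in> S"
    and min: "\<And>x. x \<in> S \<Longrightarrow> x \<noteq> (\<lambda>_. 0) \<Longrightarrow> p \<le> sup_abs x"
    and p: "0 < p" "p \<le> M"
  shows "real (card {x \<in> S. sup_abs x \<le> M}) \<le> (6 * real M / real p)\<^sup>2"
proof -
  obtain i j where ij: "\<And>x k. x \<in> S \<Longrightarrow> \<bar>x k\<bar> \<le> \<bar>x i\<bar> + \<bar>x j\<bar>"
    using rank_le_2_dominating_coordinates[OF rank] by blast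
  define h where "h = (int p + 1) div 2"
  have "2 * h = int p \<or> 2 * h = int p + 1" unfolding h_def by presburger
  then have h: "h > 0" "2 * h \<ge> int p" "2 * (h - 1) < int p" using p by auto
  define J where "J = (\<lambda>x. x div h) ` {- int M..int M}"
  define f where "f x = (x i div h, x j div h)" for x :: "'i \<Rightarrow> int"
  have cell: "\<bar>a - b\<bar> \<le> h - 1" if "a div h = b div h" for a b
  proof -
    have "a - b = a mod h - b mod h" using that by (metis add_diff_cancel_left mult_div_mod_eq)
    moreover have "0 \<le> a mod h" "a mod h < h" "0 \<le> b mod h" "b mod h < h" using h by auto
    ultimately show ?thesis by linarith
  qed
  have "inj_on f {x \<in> S. sup_abs x \<le> M}"
  proof (rule inj_onI, rule ccontr)
    fix x y assume xy: "x \<in> {x \<in> S. sup_abs x \<le> M}" "y \<in> {x \<in> S. sup_abs x \<le> M}" "f x = f y" "x \<noteq> y"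
    define z where "z = (\<lambda>i. x i - y i)"
    have z: "z \<in> S" "z \<noteq> (\<lambda>_. 0)" using xy diff by (auto simp: z_def fun_eq_iff)
    have "\<bar>z i\<bar> \<le> h - 1" "\<bar>z j\<bar> \<le> h - 1" using xy(3) cell by (auto simp: z_def f_def)
    then have zk: "\<bar>z k\<bar> \<le> (h - 1) + (h - 1)" for k by (meson ij[OF z(1), of k] add_mono order_trans)
    have h3: "h - 1 + (h - 1) < int p" using h(3) by simp
    have "\<bar>z k\<bar> < int p" for k
      by (rule order.strict_trans1[OF zk h3])
    then have "int (sup_abs z) < int p" using sup_abs_attained[of z] by metis
    with min[OF z] show False by simp
  qed
  moreover have "f ` {x \<in> S. sup_abs x \<le> M} \<subseteq> J \<times> J"
  proof (rule image_subsetI)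
    fix x assume "x \<in> {x \<in> S. sup_abs x \<le> M}"
    then have "\<bar>x k\<bar> \<le> int M" for k by (simp add: sup_abs_le_iff)
    then have "x k \<in> {- int M..int M}" for k by (simp add: abs_le_iff minus_le_iff)
    then show "f x \<in> J \<times> J" unfolding f_def J_def by blast
  qed
  moreover have "finite (J \<times> J)" by (simp add: J_def)
  ultimately have "card {x \<in> S. sup_abs x \<le> M} \<le> card (J \<times> J)" by (metis card_inj_on_le)
  then have "real (card {x \<in> S. sup_abs x \<le> M}) \<le> (real (card J))\<^sup>2"
    by (simp add: power2_eq_square card_cartesian_product flip: of_nat_mult)
  also have "real (card J) \<le> 6 * real M / real p"
  proof -
    have "real (card J) \<le> 2 * real M / real_of_int h + 2" unfolding J_def using card_div_interval_le[OF h(1)] .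
    also have "2 * real M / real_of_int h \<le> 2 * real M / (real p / 2)"
      using h p by (intro divide_left_mono) auto
    \<comment> \<open>Here \<open>p\<close> is at most \<open>M\<close>, so the summand 2 is
      absorbed into \<open>2 * M / p\<close>.\<close>
    also have "2 * real M / (real p / 2) + 2 \<le> 6 * real M / real p" using p by (simp add: field_simps)
    finally show ?thesis by simp
  qed
  then have "(real (card J))\<^sup>2 \<le> (6 * real M / real p)\<^sup>2" by (intro power_mono) auto
  finally show ?thesis .
qed

section \<open>Shells of boxes and sums of inverse powers\<close>

text \<open>The shell is covered by two faces for each coordinate, each face having
  \<open>2 * k + 1\<close>, at most \<open>3 * k\<close>, choices for every other
  coordinate.\<close>

lemma card_box_shell_le:
  assumes "finite I" "0 < k"
  shows "real (card {x \<in> I \<rightarrow>\<^sub>E {- int k..int k}. \<exists>i\<in>I. \<bar>x i\<bar> = int k}) \<le> 2 * real (card I) * 3 ^ (card I - 1) * real k ^ (card I - 1)"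
proof -
  define F where "F i s = (\<Pi>\<^sub>E j\<in>I. if j = i then {s} else {- int k..int k})" for i s
  have "{x \<in> I \<rightarrow>\<^sub>E {- int k..int k}. \<exists>i\<in>I. \<bar>x i\<bar> = int k} \<subseteq> (\<Union>i\<in>I. \<Union>s\<in>{int k, - int k}. F i s)"
  proof
    fix x assume "x \<in> {x \<in> I \<rightarrow>\<^sub>E {- int k..int k}. \<exists>i\<in>I. \<bar>x i\<bar> = int k}"
    then obtain i where "x \<in> I \<rightarrow>\<^sub>E {- int k..int k}" "i \<in> I" "\<bar>x i\<bar> = int k" by auto
    moreover from this have "x \<in> F i (x i)" unfolding F_def PiE_iff by auto
    moreover have "x i \<in> {int k, - int k}" using \<open>\<bar>x i\<bar> = int k\<close> by auto
    ultimately show "x \<in> (\<Union>i\<in>I. \<Union>s\<in>{int k, - int k}. F i s)" by blast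
  qed
  moreover have finF: "finite (F i s)" for i s unfolding F_def using assms by (intro finite_PiE) auto
  ultimately have "card {x \<in> I \<rightarrow>\<^sub>E {- int k..int k}. \<exists>i\<in>I. \<bar>x i\<bar> = int k} \<le> card (\<Union>i\<in>I. \<Union>s\<in>{int k, - int k}. F i s)"
    using assms by (intro card_mono) auto
  also have "\<dots> \<le> (\<Sum>i\<in>I. card (\<Union>s\<in>{int k, - int k}. F i s))" by (rule card_UN_le) fact
  also have "\<dots> \<le> (\<Sum>i\<in>I. 2 * (2 * k + 1) ^ (card I - 1))"
  proof (rule sum_mono)
    fix i assume i: "i \<in> I"
    have c: "card (F i s) = (2 * k + 1) ^ (card I - 1)" for s
    proof -
      have "card (F i s) = (\<Prod>j\<in>I. card (if j = i then {s} else {- int k..int k}))"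
        unfolding F_def by (rule card_PiE) fact
      also have "\<dots> = (\<Prod>j\<in>I - {i}. 2 * k + 1)"
        by (subst prod.remove[OF assms(1) i]) (simp add: nat_add_distrib nat_mult_distrib)
      finally show ?thesis using i by simp
    qed
    have "card (\<Union>s\<in>{int k, - int k}. F i s) \<le> (\<Sum>s\<in>{int k, - int k}. card (F i s))" by (rule card_UN_le) simp
    also have "\<dots> = 2 * (2 * k + 1) ^ (card I - 1)" using assms by (simp add: c)
    finally show "card (\<Union>s\<in>{int k, - int k}. F i s) \<le> 2 * (2 * k + 1) ^ (card I - 1)" .
  qed
  also have "\<dots> = 2 * card I * (2 * k + 1) ^ (card I - 1)" by simp
  also have "\<dots> \<le> 2 * card I * (3 * k) ^ (card I - 1)" using assms by (intro mult_left_mono power_mono) auto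
  finally show ?thesis by (metis (mono_tags, lifting) of_nat_le_iff of_nat_mult of_nat_numeral of_nat_power power_mult_distrib mult.assoc)
qed

lemma card_sup_abs_shell_le:
  fixes I :: "'i::finite set"
  assumes "0 < k"
  shows "real (card {x. (\<forall>i. i \<notin> I \<longrightarrow> x i = 0) \<and> sup_abs x = k}) \<le> 2 * real (card I) * 3 ^ (card I - 1) * real k ^ (card I - 1)"
proof -
  let ?S = "{x. (\<forall>i. i \<notin> I \<longrightarrow> x i = 0) \<and> sup_abs x = k}"
  let ?T = "{x \<in> I \<rightarrow>\<^sub>E {- int k..int k}. \<exists>i\<in>I. \<bar>x i\<bar> = int k}"
  have "card ?S \<le> card ?T"
  proof (rule card_inj_on_le[of "\<lambda>x. restrict x I"])
    show "inj_on (\<lambda>x. restrict x I) ?S"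
      by (rule inj_onI, rule ext) (metis (mono_tags, lifting) mem_Collect_eq restrict_apply')
    show "(\<lambda>x. restrict x I) ` ?S \<subseteq> ?T"
    proof (rule image_subsetI)
      fix x assume x: "x \<in> ?S"
      have "\<bar>x i\<bar> \<le> int k" for i using x abs_le_sup_abs[of x i] by simp
      then have "x i \<in> {- int k..int k}" for i by (simp add: abs_le_iff minus_le_iff)
      moreover obtain i where "\<bar>x i\<bar> = int k" using x sup_abs_attained[of x] by auto
      moreover from this have "i \<in> I" using x assms by auto
      ultimately show "restrict x I \<in> ?T" by auto
    qed
    show "finite ?T" using finite_PiE[of I "\<lambda>_. {- int k..int k}"] by auto
  qed
  then have "real (card ?S) \<le> real (card ?T)" by simp
  also note card_box_shell_le[OF finite assms]
  finally show ?thesis .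
qed

lemma sup_abs_ball:
  fixes I :: "'i::finite set"
  shows "finite {x. (\<forall>i. i \<notin> I \<longrightarrow> x i = 0) \<and> sup_abs x \<le> k}"
    and "card {x. (\<forall>i. i \<notin> I \<longrightarrow> x i = 0) \<and> sup_abs x \<le> k} = (2 * k + 1) ^ card I"
proof -
  let ?S = "{x. (\<forall>i. i \<notin> I \<longrightarrow> x i = 0) \<and> sup_abs x \<le> k}"
  let ?T = "I \<rightarrow>\<^sub>E {- int k..int k}"
  have b: "bij_betw (\<lambda>x. restrict x I) ?S ?T"
  proof (rule bij_betwI[where g = "\<lambda>x i. if i \<in> I then x i else 0"])
    show "(\<lambda>x. restrict x I) \<in> ?S \<rightarrow> ?T"
    proof
      fix x assume x: "x \<in> ?S"
      have "\<bar>x i\<bar> \<le> int k" for i using x by (simp add: sup_abs_le_iff)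
      then have "x i \<in> {- int k..int k}" for i by (simp add: abs_le_iff minus_le_iff)
      then show "restrict x I \<in> ?T" by auto
    qed
    show "(\<lambda>x i. if i \<in> I then x i else 0) \<in> ?T \<rightarrow> ?S"
      by (auto simp: sup_abs_le_iff abs_le_iff PiE_iff minus_le_iff)
  qed (auto simp: fun_eq_iff PiE_iff extensional_def)
  have "finite ?T" by (intro finite_PiE) auto
  then show "finite ?S" using b bij_betw_finite by blast
  have "card ?S = card ?T" using b by (rule bij_betw_same_card)
  also have "\<dots> = (2 * k + 1) ^ card I" by (simp add: card_PiE nat_add_distrib nat_mult_distrib)
  finally show "card ?S = (2 * k + 1) ^ card I" .
qed

text \<open>Sorted by the value k of \<open>h\<close>, the sum has \<open>M\<close> shells, each
  contributing at most C k^m.\<close>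

lemma sum_inverse_power_shells_le:
  fixes h :: "'a \<Rightarrow> nat"
  assumes "finite S" "\<And>x. x \<in> S \<Longrightarrow> 0 < h x \<and> h x \<le> M"
    and shell: "\<And>k. 0 < k \<Longrightarrow> real (card {x \<in> S. h x = k}) \<le> C * real k ^ (e + m)" and "C \<ge> 0"
  shows "(\<Sum>x\<in>S. 1 / real (h x) ^ e) \<le> C * real M ^ (m + 1)"
proof -
  have "(\<Sum>x\<in>S. 1 / real (h x) ^ e) = (\<Sum>k\<in>{1..M}. \<Sum>x\<in>{x\<in>S. h x = k}. 1 / real (h x) ^ e)"
    using assms(2) by (intro sum.group[symmetric] assms(1)) (auto simp: Suc_le_eq)
  also have "\<dots> = (\<Sum>k\<in>{1..M}. real (card {x\<in>S. h x = k}) / real k ^ e)"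
    by (intro sum.cong) auto
  also have "\<dots> \<le> (\<Sum>k\<in>{1..M}. C * real M ^ m)"
  proof (rule sum_mono)
    fix k assume k: "k \<in> {1..M}"
    have "real (card {x\<in>S. h x = k}) / real k ^ e \<le> C * real k ^ (e + m) / real k ^ e"
      using k shell[of k] by (intro divide_right_mono) auto
    also have "\<dots> = C * real k ^ m" using k by (simp add: power_add)
    also have "\<dots> \<le> C * real M ^ m" using k assms(4) by (intro mult_left_mono power_mono) auto
    finally show "real (card {x\<in>S. h x = k}) / real k ^ e \<le> C * real M ^ m" .
  qed
  finally show ?thesis by (simp add: algebra_simps)
qed

text \<open>In dimension \<open>e + m + 1\<close> the shell of norm k has O(k^(e + m)) points. The
  instances used are dimension 8 with \<open>e = 4\<close> (matrices modulo scalars) and dimension 3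
  with \<open>e = 2\<close> (the rank-one factors).\<close>

lemma sum_inverse_sup_abs_le:
  fixes I :: "'i::finite set" and f :: "'a \<Rightarrow> 'i \<Rightarrow> int"
  assumes "inj f" "\<And>x. x \<in> S \<Longrightarrow> 0 < sup_abs (f x) \<and> sup_abs (f x) \<le> M"
    and "\<And>x i. x \<in> S \<Longrightarrow> i \<notin> I \<Longrightarrow> f x i = 0" and "card I = e + m + 1"
  shows "(\<Sum>x\<in>S. 1 / real (sup_abs (f x)) ^ e) \<le> 2 * real (card I) * 3 ^ (e + m) * real M ^ (m + 1)"
proof (rule sum_inverse_power_shells_le)
  show "finite S"
  proof (rule inj_on_finite[of f])
    show "inj_on f S" using assms(1) inj_on_subset by blast
    show "f ` S \<subseteq> {x. (\<forall>i. i \<notin> I \<longrightarrow> x i = 0) \<and> sup_abs x \<le> M}" using assms(2,3) by auto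
  qed (rule sup_abs_ball)
  show "0 < sup_abs (f x) \<and> sup_abs (f x) \<le> M" if "x \<in> S" for x using assms(2) that .
  fix k :: nat assume k: "0 < k"
  have "card {x \<in> S. sup_abs (f x) = k} \<le> card {x. (\<forall>i. i \<notin> I \<longrightarrow> x i = 0) \<and> sup_abs x = k}"
  proof (rule card_inj_on_le[of f])
    show "inj_on f {x \<in> S. sup_abs (f x) = k}" using assms(1) inj_on_subset by blast
    show "f ` {x \<in> S. sup_abs (f x) = k} \<subseteq> {x. (\<forall>i. i \<notin> I \<longrightarrow> x i = 0) \<and> sup_abs x = k}" using assms(3) by auto
    show "finite {x. (\<forall>i. i \<notin> I \<longrightarrow> x i = 0) \<and> sup_abs x = k}"
      by (rule finite_subset[OF _ sup_abs_ball(1)[of I k]]) auto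
  qed
  then have "real (card {x \<in> S. sup_abs (f x) = k}) \<le> real (card {x. (\<forall>i. i \<notin> I \<longrightarrow> x i = 0) \<and> sup_abs x = k})" by simp
  also note card_sup_abs_shell_le[OF k, of I]
  finally show "real (card {x \<in> S. sup_abs (f x) = k}) \<le> 2 * real (card I) * 3 ^ (e + m) * real k ^ (e + m)"
    using assms(4) by simp
qed simp

section \<open>Derogatory matrices\<close>

definition entries :: "'a ^ 'n ^ 'm \<Rightarrow> 'm \<times> 'n \<Rightarrow> 'a" where
  "entries A = (\<lambda>(i, j). A $ i $ j)"

abbreviation height :: "int ^ 'n ^ 'm \<Rightarrow> nat" where
  "height A \<equiv> sup_abs (entries A)"

abbreviation vheight :: "int ^ 'n \<Rightarrow> nat" where
  "vheight u \<equiv> sup_abs (($) u)"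

lemma inj_entries: "inj entries"
  by (rule injI) (auto simp: entries_def fun_eq_iff vec_eq_iff)

lemma inj_vec_nth: "inj (($) :: 'a ^ 'n \<Rightarrow> 'n \<Rightarrow> 'a)"
  by (rule injI) (simp add: vec_eq_iff)

lemma height_le_iff: "height A \<le> k \<longleftrightarrow> (\<forall>i j. \<bar>A $ i $ j\<bar> \<le> int k)"
  by (simp add: sup_abs_le_iff entries_def)

lemma entry_le_height: "\<bar>A $ i $ j\<bar> \<le> int (height A)"
  using height_le_iff by blast

lemma height_pos_iff: "0 < height A \<longleftrightarrow> A \<noteq> 0"
  using sup_abs_eq_0_iff[of "entries A"] by (auto simp: entries_def fun_eq_iff vec_eq_iff)

lemma vheight_pos_iff: "0 < vheight u \<longleftrightarrow> u \<noteq> 0"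
  using sup_abs_eq_0_iff[of "($) u"] by (auto simp: fun_eq_iff vec_eq_iff)

definition reduced_ball :: "nat \<Rightarrow> (int ^ 3 ^ 3) set" where
  "reduced_ball M = {A. A $ 3 $ 3 = 0 \<and> height A \<le> M}"

lemma entries_reduced_ball:
  "entries ` reduced_ball M = {x. (\<forall>i. i \<notin> - {(3, 3)} \<longrightarrow> x i = 0) \<and> sup_abs x \<le> M}"
proof -
  have "x \<in> entries ` reduced_ball M" if "x (3, 3) = 0" "sup_abs x \<le> M" for x
  proof (rule image_eqI)
    show e: "x = entries (\<chi> i j. x (i, j))" by (auto simp: entries_def)
    show "(\<chi> i j. x (i, j)) \<in> reduced_ball M"
      using that unfolding reduced_ball_def mem_Collect_eq e[symmetric] by simp
  qed
  then show ?thesis by (auto simp: reduced_ball_def entries_def)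
qed

lemma finite_reduced_ball: "finite (reduced_ball M)"
  and card_reduced_ball: "card (reduced_ball M) = (2 * M + 1) ^ 8"
proof -
  have inj: "inj_on entries (reduced_ball M)" using inj_entries inj_on_subset by blast
  show "finite (reduced_ball M)"
    using finite_imageD[OF _ inj] sup_abs_ball(1)[of "- {(3 :: 3, 3 :: 3)}" M] by (simp only: entries_reduced_ball)
  have "card (- {(3, 3) :: 3 \<times> 3}) = 8" by (simp add: Compl_eq_Diff_UNIV card_Diff_singleton)
  then show "card (reduced_ball M) = (2 * M + 1) ^ 8"
    using card_image[OF inj] sup_abs_ball(2)[of "- {(3 :: 3, 3 :: 3)}" M] by (simp only: entries_reduced_ball)
qed

lemma sum_inverse_height_power4_le:
  "(\<Sum>A\<in>reduced_ball M - {0}. 1 / real (height A) ^ 4) \<le> 34992 * real M ^ 4"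
proof -
  have c: "card (- {(3, 3) :: 3 \<times> 3}) = 4 + 3 + 1" by (simp add: Compl_eq_Diff_UNIV card_Diff_singleton)
  have "(\<Sum>A\<in>reduced_ball M - {0}. 1 / real (height A) ^ 4)
      \<le> 2 * real (card (- {(3, 3) :: 3 \<times> 3})) * 3 ^ (4 + 3) * real M ^ (3 + 1)"
    by (rule sum_inverse_sup_abs_le[OF inj_entries _ _ c])
       (auto simp: reduced_ball_def height_pos_iff, auto simp: entries_def)
  then show ?thesis by (simp add: c)
qed

lemma sum_inverse_vheight_power2_le:
  "(\<Sum>u\<in>{u :: int ^ 3. u \<noteq> 0 \<and> vheight u \<le> M}. 1 / real (vheight u) ^ 2) \<le> 54 * real M"
proof -
  have c: "card (UNIV :: 3 set) = 2 + 0 + 1" by simp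
  have "(\<Sum>u\<in>{u :: int ^ 3. u \<noteq> 0 \<and> vheight u \<le> M}. 1 / real (vheight u) ^ 2)
      \<le> 2 * real (card (UNIV :: 3 set)) * 3 ^ (2 + 0) * real M ^ (0 + 1)"
    by (rule sum_inverse_sup_abs_le[OF inj_vec_nth _ _ c]) (auto simp: vheight_pos_iff)
  then show ?thesis by simp
qed

section \<open>Rank-one factors and the centralizer of a derogatory matrix\<close>

lemma primitive_nonzero:
  fixes u :: "int ^ 'n" assumes "Gcd (range (($) u)) = 1" shows "u \<noteq> 0"
  using assms by auto

lemma derogatory_unique:
  fixes A B :: "int ^ 3 ^ 3"
  assumes "derogatory A u v" "derogatory B u v" "A $ 3 $ 3 = B $ 3 $ 3"
  shows "A = B"
proof -
  obtain a b where "\<And>i j. A $ i $ j = u $ i * v $ j + (if i = j then a else 0)"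
    "\<And>i j. B $ i $ j = u $ i * v $ j + (if i = j then b else 0)"
    using assms unfolding derogatory_def by blast
  with assms(3) show ?thesis by (simp add: vec_eq_iff)
qed

text \<open>Off the diagonal the products u_i v_j are entries of \<open>A\<close>; on it only their
  differences from u_3 v_3 are. If the largest product were diagonal and exceeded 2H, some other u_k
  v_k would exceed H, so u_i v_k times u_k v_i would exceed 2H^2, although both are off-diagonal
  entries and bounded by H.\<close>

lemma vheight_mult_le_height:
  fixes A :: "int ^ 3 ^ 3"
  assumes "derogatory A u v" "A $ 3 $ 3 = 0"
  shows "vheight u * vheight v \<le> 2 * height A"
proof -
  obtain l where A: "\<And>i j. A $ i $ j = u $ i * v $ j + (if i = j then l else 0)"
    using assms unfolding derogatory_def by blast
  define H where "H = int (height A)"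
  have H: "\<bar>A $ i $ j\<bar> \<le> H" for i j using entry_le_height by (simp add: H_def)
  have H0: "H \<ge> 0" by (simp add: H_def)
  have off: "\<bar>u $ i * v $ j\<bar> \<le> H" if "i \<noteq> j" for i j using H[of i j] that by (simp add: A)
  have l: "l = - (u $ 3 * v $ 3)" using assms(2) by (simp add: A)
  have diag: "\<bar>u $ i * v $ i - u $ 3 * v $ 3\<bar> \<le> H" for i using H[of i i] by (simp add: A l)
  obtain i where i: "\<bar>u $ i\<bar> = int (vheight u)" using sup_abs_attained by blast
  obtain j where j: "\<bar>v $ j\<bar> = int (vheight v)" using sup_abs_attained by blast
  have "\<bar>u $ i * v $ j\<bar> \<le> 2 * H"
  proof (cases "i = j")
    case False
    then show ?thesis using off[of i j] H0 by linarith
  next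
    case True
    \<comment> \<open>One of the two indices must be 3, since the normalisation bounds only
      differences from u_3 v_3 directly.\<close>
    obtain k where k: "k \<noteq> i" "\<bar>u $ i * v $ i - u $ k * v $ k\<bar> \<le> H"
    proof (cases "i = 3")
      case True
      have "(1::3) \<noteq> 3" by simp
      then show ?thesis using that[of 1] True diag[of 1] by (simp add: abs_minus_commute)
    next
      case False
      then show ?thesis using that[of 3] diag[of i] by auto
    qed
    show ?thesis
    proof (rule ccontr)
      assume "\<not> ?thesis"
      then have *: "\<bar>u $ i * v $ i\<bar> > 2 * H" using True by simp
      then have **: "\<bar>u $ k * v $ k\<bar> > H" using k(2) by linarith
      have "\<bar>u $ i * v $ k\<bar> * \<bar>u $ k * v $ i\<bar> \<le> H * H"
        using off k(1) H0 by (intro mult_mono) auto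
      also have "\<dots> \<le> (2 * H) * H" using H0 by (intro mult_right_mono) auto
      also have "\<dots> < \<bar>u $ i * v $ i\<bar> * \<bar>u $ k * v $ k\<bar>"
        using * ** H0 by (intro mult_strict_mono') auto
      finally show False by (simp add: abs_mult mult_ac)
    qed
  qed
  then have "int (vheight u * vheight v) \<le> int (2 * height A)" by (simp add: abs_mult i j H_def)
  then show ?thesis by linarith
qed

text \<open>Commutation says that the rank-one matrices u (v^T B) and (B u) v^T coincide. Hence B u
  is parallel to u and v^T B to v^T with the same factor, an integer because \<open>u\<close> is
  primitive.\<close>

lemma derogatory_commute_eigen:
  fixes A B :: "int ^ 'n ^ 'n"
  assumes "derogatory A u v" and comm: "A ** B = B ** A"
  shows "\<exists>c. (\<forall>i. (\<Sum>k\<in>UNIV. B $ i $ k * u $ k) = c * u $ i) \<and> (\<forall>j. (\<Sum>k\<in>UNIV. v $ k * B $ k $ j) = c * v $ j)"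
proof -
  obtain l where A: "\<And>i j. A $ i $ j = u $ i * v $ j + (if i = j then l else 0)"
    and g: "Gcd (range (($) u)) = 1" and "v \<noteq> 0"
    using assms unfolding derogatory_def by blast
  obtain m where m: "v $ m \<noteq> 0" using \<open>v \<noteq> 0\<close> by (auto simp: vec_eq_iff)
  obtain n where n: "u $ n \<noteq> 0" using primitive_nonzero[OF g] by (auto simp: vec_eq_iff)
  define x where "x i = (\<Sum>k\<in>UNIV. B $ i $ k * u $ k)" for i
  define y where "y j = (\<Sum>k\<in>UNIV. v $ k * B $ k $ j)" for j
  have 1: "(A ** B) $ i $ j = u $ i * y j + l * B $ i $ j" for i j
  proof -
    have "(A ** B) $ i $ j = (\<Sum>k\<in>UNIV. u $ i * (v $ k * B $ k $ j) + (if k = i then l * B $ i $ j else 0))"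
      unfolding matrix_matrix_mult_def by (auto simp: A algebra_simps intro!: sum.cong)
    then show ?thesis by (simp add: sum.distrib y_def sum_distrib_left)
  qed
  have 2: "(B ** A) $ i $ j = x i * v $ j + l * B $ i $ j" for i j
  proof -
    have "(B ** A) $ i $ j = (\<Sum>k\<in>UNIV. (B $ i $ k * u $ k) * v $ j + (if k = j then l * B $ i $ j else 0))"
      unfolding matrix_matrix_mult_def by (auto simp: A algebra_simps intro!: sum.cong)
    then show ?thesis by (simp add: sum.distrib x_def sum_distrib_right)
  qed
  have xy: "u $ i * y j = x i * v $ j" for i j using 1[of i j] 2[of i j] comm by simp
  have "\<exists>c. \<forall>i. x i = c * u $ i"
  proof (rule primitive_parallel[OF g n])
    fix i
    have "v $ m * (x i * u $ n) = v $ m * (u $ i * x n)"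
      using xy[of i m] xy[of n m] by algebra
    then show "x i * u $ n = u $ i * x n" using m by simp
  qed
  then obtain c where c: "\<And>i. x i = c * u $ i" by blast
  have "u $ n * y j = u $ n * (c * v $ j)" for j using xy[of n j] by (simp add: c)
  then have "y j = c * v $ j" for j using n by simp
  with c show ?thesis unfolding x_def y_def by blast
qed

text \<open>As \<open>v $ m\<close> and \<open>u $ n\<close> are nonzero, the two kernel conditions
  recover row \<open>m\<close> and column \<open>n\<close> from the remaining entries.\<close>

lemma kernel_cokernel_eq_0:
  fixes D :: "int ^ 'n ^ 'n"
  assumes "\<And>i. (\<Sum>k\<in>UNIV. D $ i $ k * u $ k) = 0" "\<And>j. (\<Sum>k\<in>UNIV. v $ k * D $ k $ j) = 0"
    and "u $ n \<noteq> 0" "v $ m \<noteq> 0" and z: "\<And>i j. i \<noteq> m \<Longrightarrow> j \<noteq> n \<Longrightarrow> D $ i $ j = 0"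
  shows "D = 0"
proof -
  have 1: "D $ i $ j = 0" if "j \<noteq> n" for i j
  proof (cases "i = m")
    case True
    have "(\<Sum>k\<in>UNIV. v $ k * D $ k $ j) = (\<Sum>k\<in>UNIV. if k = m then v $ m * D $ m $ j else 0)"
      using that by (intro sum.cong) (auto simp: z)
    then show ?thesis using assms(2)[of j] assms(4) True by simp
  qed (simp add: z that)
  have "D $ i $ n = 0" for i
  proof -
    have "(\<Sum>k\<in>UNIV. D $ i $ k * u $ k) = (\<Sum>k\<in>UNIV. if k = n then D $ i $ n * u $ n else 0)"
      by (intro sum.cong) (auto simp: 1)
    then show ?thesis using assms(1)[of i] assms(3) by simp
  qed
  with 1 show ?thesis by (metis vec_eq_iff zero_index)
qed

text \<open>If \<open>c\<close> is the eigenvalue of \<open>B\<close> on \<open>u\<close>, then \<open>B - c I\<close> kills \<open>u\<close> and is killed by \<open>v\<close>, hence is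
  determined by four entries; \<open>c\<close> itself is then read off from the normalisation \<open>B $ 3 $ 3 = 0\<close>.\<close>

lemma card_centralizer_derogatory_le:
  fixes A :: "int ^ 3 ^ 3"
  assumes der: "derogatory A u v" and M: "1 \<le> M"
  shows "card {B \<in> reduced_ball M. A ** B = B ** A} \<le> (9 * M) ^ 4"
proof -
  let ?S = "{B \<in> reduced_ball M. A ** B = B ** A}"
  have g: "Gcd (range (($) u)) = 1" and "v \<noteq> 0" using der unfolding derogatory_def by auto
  obtain m where m: "v $ m \<noteq> 0" using \<open>v \<noteq> 0\<close> by (auto simp: vec_eq_iff)
  obtain n where n: "\<bar>u $ n\<bar> = int (vheight u)" using sup_abs_attained by blast
  have un: "u $ n \<noteq> 0" using n vheight_pos_iff[of u] primitive_nonzero[OF g] by auto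
  have "\<forall>B. \<exists>c. B \<in> ?S \<longrightarrow> (\<forall>i. (\<Sum>k\<in>UNIV. B $ i $ k * u $ k) = c * u $ i) \<and> (\<forall>j. (\<Sum>k\<in>UNIV. v $ k * B $ k $ j) = c * v $ j)"
    using derogatory_commute_eigen[OF der] by blast
  from choice[OF this] obtain c where c: "\<And>B i. B \<in> ?S \<Longrightarrow> (\<Sum>k\<in>UNIV. B $ i $ k * u $ k) = c B * u $ i"
     "\<And>B j. B \<in> ?S \<Longrightarrow> (\<Sum>k\<in>UNIV. v $ k * B $ k $ j) = c B * v $ j" by auto
  \<comment> \<open>The eigenvalue equation is read in the coordinate \<open>n\<close> where
    \<open>u\<close> is largest.\<close>
  have cM: "\<bar>c B\<bar> \<le> 3 * int M" if B: "B \<in> ?S" for B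
  proof -
    have "\<bar>c B\<bar> * \<bar>u $ n\<bar> = \<bar>\<Sum>k\<in>UNIV. B $ n $ k * u $ k\<bar>" using c(1)[OF B, of n] by (simp add: abs_mult)
    also have "\<dots> \<le> (\<Sum>k\<in>UNIV. \<bar>B $ n $ k * u $ k\<bar>)" by (rule sum_abs)
    also have "\<dots> \<le> (\<Sum>k\<in>(UNIV::3 set). int M * \<bar>u $ n\<bar>)"
    proof (rule sum_mono)
      fix k
      show "\<bar>B $ n $ k * u $ k\<bar> \<le> int M * \<bar>u $ n\<bar>"
        unfolding abs_mult n using B abs_le_sup_abs[of "($) u" k]
        by (intro mult_mono) (auto simp: reduced_ball_def height_le_iff)
    qed
    also have "\<dots> = (3 * int M) * \<bar>u $ n\<bar>" by simp
    finally show ?thesis using un by simp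
  qed
  define C where "C B = (\<chi> i j. B $ i $ j - (if i = j then c B else 0))" for B :: "int ^ 3 ^ 3"
  define I where "I = (UNIV - {m}) \<times> (UNIV - {n})"
  define f where "f B = (\<lambda>(i, j). if (i, j) \<in> I then C B $ i $ j else 0)" for B
  \<comment> \<open>The radius \<open>4 * M\<close> is \<open>M\<close> for an entry of
    \<open>B\<close> plus \<open>3 * M\<close> for the eigenvalue.\<close>
  have "card ?S \<le> card {x. (\<forall>i. i \<notin> I \<longrightarrow> x i = 0) \<and> sup_abs x \<le> 4 * M}"
  proof (rule card_inj_on_le[of f])
    show "inj_on f ?S"
    proof (rule inj_onI)
      fix B B' assume B: "B \<in> ?S" "B' \<in> ?S" "f B = f B'"
      have Cu: "(\<Sum>k\<in>UNIV. C B $ i $ k * u $ k) = 0" if "B \<in> ?S" for B i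
      proof -
        have "(\<Sum>k\<in>UNIV. C B $ i $ k * u $ k) = (\<Sum>k\<in>UNIV. B $ i $ k * u $ k - (if k = i then c B * u $ i else 0))"
          by (intro sum.cong) (auto simp: C_def algebra_simps)
        then show ?thesis using c(1)[OF that] by (simp add: sum_subtractf)
      qed
      have Cv: "(\<Sum>k\<in>UNIV. v $ k * C B $ k $ j) = 0" if "B \<in> ?S" for B j
      proof -
        have "(\<Sum>k\<in>UNIV. v $ k * C B $ k $ j) = (\<Sum>k\<in>UNIV. v $ k * B $ k $ j - (if k = j then c B * v $ j else 0))"
          by (intro sum.cong) (auto simp: C_def algebra_simps)
        then show ?thesis using c(2)[OF that] by (simp add: sum_subtractf)
      qed
      have "C B - C B' = 0"
      proof (rule kernel_cokernel_eq_0[OF _ _ un m])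
        show "(\<Sum>k\<in>UNIV. (C B - C B') $ i $ k * u $ k) = 0" for i
          using Cu[OF B(1), of i] Cu[OF B(2), of i] by (simp add: left_diff_distrib sum_subtractf)
        show "(\<Sum>k\<in>UNIV. v $ k * (C B - C B') $ k $ j) = 0" for j
          using Cv[OF B(1), of j] Cv[OF B(2), of j] by (simp add: right_diff_distrib sum_subtractf)
        show "(C B - C B') $ i $ j = 0" if "i \<noteq> m" "j \<noteq> n" for i j
          using fun_cong[OF B(3), of "(i, j)"] that by (simp add: f_def I_def)
      qed
      then have CC: "C B $ i $ j = C B' $ i $ j" for i j by simp
      have "c B = c B'" using CC[of 3 3] B by (simp add: C_def reduced_ball_def)
      then have "B $ i $ j = B' $ i $ j" for i j using CC[of i j] by (cases "i = j") (simp_all add: C_def)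
      then show "B = B'" by (simp add: vec_eq_iff)
    qed
    show "f ` ?S \<subseteq> {x. (\<forall>i. i \<notin> I \<longrightarrow> x i = 0) \<and> sup_abs x \<le> 4 * M}"
    proof (rule image_subsetI)
      fix B assume B: "B \<in> ?S"
      have "\<bar>B $ i $ j - (if i = j then c B else 0)\<bar> \<le> 4 * int M" for i j
      proof -
        have "\<bar>B $ i $ j\<bar> \<le> int M" using B by (simp add: reduced_ball_def height_le_iff)
        then show ?thesis using cM[OF B] abs_triangle_ineq4[of "B $ i $ j" "c B"] by (cases "i = j") simp_all
      qed
      then show "f B \<in> {x. (\<forall>i. i \<notin> I \<longrightarrow> x i = 0) \<and> sup_abs x \<le> 4 * M}"
        by (auto simp: f_def sup_abs_le_iff C_def)
    qed
  qed (rule sup_abs_ball)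
  also have "\<dots> = (2 * (4 * M) + 1) ^ card I" by (rule sup_abs_ball)
  also have "card I = 4" unfolding I_def by (simp add: card_cartesian_product card_Diff_singleton)
  also have "(2 * (4 * M) + 1) ^ 4 \<le> (9 * M) ^ 4" using M by (intro power_mono) auto
  finally show ?thesis .
qed

text \<open>By \<open>vheight_mult_le_height\<close> each term is at most 4 / (|u| |v|)^2, and the
  sum over all pairs (u, v) factors into a square. The constant is 4 * 108^2.\<close>

lemma sum_derogatory_le:
  "(\<Sum>A\<in>{A \<in> reduced_ball M. \<exists>u v. derogatory A u v}. 1 / real (height A) ^ 2) \<le> 46656 * real M ^ 2"
proof -
  let ?D = "{A \<in> reduced_ball M. \<exists>u v. derogatory A u v}"
  let ?V = "{u :: int ^ 3. u \<noteq> 0 \<and> vheight u \<le> 2 * M}"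
  have "\<forall>A. \<exists>uv. A \<in> ?D \<longrightarrow> derogatory A (fst uv) (snd uv)" by auto
  from choice[OF this] obtain f where f: "\<And>A. A \<in> ?D \<Longrightarrow> derogatory A (fst (f A)) (snd (f A))" by auto
  define w where "w u = 1 / real (vheight u) ^ 2" for u :: "int ^ 3"
  have uv: "fst (f A) \<noteq> 0" "snd (f A) \<noteq> 0" "vheight (fst (f A)) * vheight (snd (f A)) \<le> 2 * height A"
    "height A \<le> M" if "A \<in> ?D" for A
    using f[OF that] primitive_nonzero[of "fst (f A)"] vheight_mult_le_height[OF f[OF that]] that
    by (auto simp: derogatory_def reduced_ball_def)
  have inj: "inj_on f ?D"
  proof (rule inj_onI)
    fix A B assume "A \<in> ?D" "B \<in> ?D" "f A = f B"
    then show "A = B" using f[of A] f[of B] derogatory_unique[of A _ _ B] by (auto simp: reduced_ball_def)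
  qed
  have sub: "f ` ?D \<subseteq> ?V \<times> ?V"
  proof (rule image_subsetI)
    fix A assume A: "A \<in> ?D"
    have pos: "0 < vheight (fst (f A))" "0 < vheight (snd (f A))" using uv[OF A] vheight_pos_iff by auto
    have le: "vheight (fst (f A)) * vheight (snd (f A)) \<le> 2 * M" using uv[OF A] by linarith
    have "vheight (fst (f A)) * 1 \<le> vheight (fst (f A)) * vheight (snd (f A))"
      "1 * vheight (snd (f A)) \<le> vheight (fst (f A)) * vheight (snd (f A))"
      using pos by (intro mult_mono; simp)+
    then have "vheight (fst (f A)) \<le> 2 * M" "vheight (snd (f A)) \<le> 2 * M" using le by linarith+
    then show "f A \<in> ?V \<times> ?V" using uv[OF A] by (simp add: mem_Times_iff)
  qed
  have finV: "finite ?V"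
  proof (rule inj_on_finite[of "($)"])
    show "inj_on ($) ?V" using inj_vec_nth inj_on_subset by blast
    show "($) ` ?V \<subseteq> {x. (\<forall>i. i \<notin> UNIV \<longrightarrow> x i = 0) \<and> sup_abs x \<le> 2 * M}" by auto
  qed (rule sup_abs_ball)
  have "(\<Sum>A\<in>?D. 1 / real (height A) ^ 2) \<le> (\<Sum>A\<in>?D. 4 * (w (fst (f A)) * w (snd (f A))))"
  proof (rule sum_mono)
    fix A assume A: "A \<in> ?D"
    have pos: "0 < vheight (fst (f A))" "0 < vheight (snd (f A))" using uv[OF A] vheight_pos_iff by auto
    have "real (vheight (fst (f A)) * vheight (snd (f A))) \<le> real (2 * height A)"
      using uv(3)[OF A] by linarith
    then have "(real (vheight (fst (f A))) * real (vheight (snd (f A)))) ^ 2 \<le> (2 * real (height A)) ^ 2"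
      by (intro power_mono) auto
    moreover have "0 < vheight (fst (f A)) * vheight (snd (f A))" using pos by simp
    then have "0 < height A" using uv(3)[OF A] by linarith
    ultimately have "4 / (2 * real (height A)) ^ 2 \<le> 4 / (real (vheight (fst (f A))) * real (vheight (snd (f A)))) ^ 2"
      using pos by (intro divide_left_mono) auto
    then show "1 / real (height A) ^ 2 \<le> 4 * (w (fst (f A)) * w (snd (f A)))"
      by (simp add: w_def power_mult_distrib)
  qed
  also have "\<dots> = 4 * (\<Sum>p\<in>f ` ?D. w (fst p) * w (snd p))"
    by (simp add: sum.reindex[OF inj] sum_distrib_left)
  also have "\<dots> \<le> 4 * (\<Sum>p\<in>?V \<times> ?V. w (fst p) * w (snd p))"
    using finV sub by (intro mult_left_mono sum_mono2) (auto simp: w_def)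
  also have "\<dots> = 4 * (\<Sum>u\<in>?V. w u) ^ 2"
    by (simp add: power2_eq_square sum_product sum.cartesian_product case_prod_beta)
  also have "\<dots> \<le> 4 * (54 * real (2 * M)) ^ 2"
    using sum_inverse_vheight_power2_le[of "2 * M"]
    by (intro mult_left_mono power_mono) (auto simp: w_def intro!: sum_nonneg)
  finally show ?thesis by (simp add: power_mult_distrib)
qed

section \<open>Counting commuting pairs\<close>

text \<open>Restricted to representatives modulo scalars with vanishing entry \<open>(3, 3)\<close>.\<close>

definition nonderogatory :: "int ^ 3 ^ 3 \<Rightarrow> bool" where
  "nonderogatory A \<longleftrightarrow> A $ 3 $ 3 = 0 \<and> A \<noteq> 0 \<and> (\<nexists>u v. derogatory A u v)"

text \<open>The centralizer modulo scalars has rank at most two: a nonderogatory matrix has a cyclic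
  vector by \<open>derogatory_if_no_cyclic_vector\<close>.\<close>

lemma nonderogatory_dependent3:
  assumes "nonderogatory A" "X \<in> reduced_centralizer A" "Y \<in> reduced_centralizer A" "Z \<in> reduced_centralizer A"
  shows "dependent3 X Y Z"
proof -
  have "A \<noteq> mat (A $ 3 $ 3)" using assms(1) by (auto simp: nonderogatory_def vec_eq_iff mat_def)
  then obtain i j k w where "distinct [i, j, k]" "det3 i j k w (A *v w) (A *v (A *v w)) \<noteq> 0"
    using derogatory_if_no_cyclic_vector[of A] assms(1) unfolding nonderogatory_def by blast
  then show ?thesis using assms(2-4) by (rule cyclic_vector_dependent3)
qed

lemma linear_relation_mult:
  fixes X Y Z P :: "int ^ 'n ^ 'n"
  assumes "\<And>i j. a * X $ i $ j + b * Y $ i $ j + c * Z $ i $ j = 0"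
  shows "a * (P ** X) $ i $ j + b * (P ** Y) $ i $ j + c * (P ** Z) $ i $ j = 0"
    and "a * (X ** P) $ i $ j + b * (Y ** P) $ i $ j + c * (Z ** P) $ i $ j = 0"
proof -
  have "a * (P ** X) $ i $ j + b * (P ** Y) $ i $ j + c * (P ** Z) $ i $ j
      = (\<Sum>k\<in>UNIV. P $ i $ k * (a * X $ k $ j + b * Y $ k $ j + c * Z $ k $ j))"
    by (simp add: matrix_matrix_mult_def sum_distrib_left distrib_left sum.distrib mult.left_commute)
  then show "a * (P ** X) $ i $ j + b * (P ** Y) $ i $ j + c * (P ** Z) $ i $ j = 0"
    by (simp add: assms)
  have "a * (X ** P) $ i $ j + b * (Y ** P) $ i $ j + c * (Z ** P) $ i $ j
      = (\<Sum>k\<in>UNIV. (a * X $ i $ k + b * Y $ i $ k + c * Z $ i $ k) * P $ k $ j)"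
    by (simp add: matrix_matrix_mult_def sum_distrib_left distrib_right sum.distrib mult.assoc)
  then show "a * (X ** P) $ i $ j + b * (Y ** P) $ i $ j + c * (Z ** P) $ i $ j = 0"
    by (simp add: assms)
qed

text \<open>\<open>A\<close>, \<open>P\<close> and \<open>X\<close> satisfy a linear relation. If
  \<open>X\<close> occurs in it, multiplying by \<open>P\<close>, which commutes with
  \<open>A\<close>, shows that \<open>P\<close> and \<open>X\<close> commute; otherwise
  \<open>P\<close> occurs, and multiplying by \<open>X\<close> does the same.\<close>

lemma reduced_centralizer_subset:
  assumes "nonderogatory A" "nonderogatory P" "P \<in> reduced_centralizer A"
  shows "reduced_centralizer A \<subseteq> reduced_centralizer P"
proof
  fix X assume X: "X \<in> reduced_centralizer A"
  have "A \<in> reduced_centralizer A" using assms(1) by (simp add: reduced_centralizer_def nonderogatory_def)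
  from nonderogatory_dependent3[OF assms(1) this assms(3) X, unfolded dependent3_def] obtain a b c where nz: "a \<noteq> 0 \<or> b \<noteq> 0 \<or> c \<noteq> 0"
    and rel: "\<And>i j. a * A $ i $ j + b * P $ i $ j + c * X $ i $ j = 0" by auto
  have comm: "A ** P = P ** A" "A ** X = X ** A" using assms(3) X by (auto simp: reduced_centralizer_def)
  have "P ** X = X ** P"
  proof (cases "c = 0")
    case False
    have "c * (P ** X) $ i $ j = c * (X ** P) $ i $ j" for i j
      using linear_relation_mult[OF rel, where P = P and i = i and j = j] unfolding comm by linarith
    then show ?thesis using False by (simp add: vec_eq_iff)
  next
    case True
    have "b \<noteq> 0"
    proof
      assume "b = 0"
      then have "a \<noteq> 0" using nz True by simp
      then have "A $ i $ j = 0" for i j using rel[of i j] \<open>b = 0\<close> True by simp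
      then have "A = 0" by (simp add: vec_eq_iff)
      then show False using assms(1) by (simp add: nonderogatory_def)
    qed
    have "b * (P ** X) $ i $ j = b * (X ** P) $ i $ j" for i j
      using linear_relation_mult[OF rel, where P = X and i = i and j = j] unfolding comm True by linarith
    then show ?thesis using \<open>b \<noteq> 0\<close> by (simp add: vec_eq_iff)
  qed
  then show "X \<in> reduced_centralizer P" using X by (simp add: reduced_centralizer_def)
qed

lemma reduced_centralizer_eq:
  assumes "nonderogatory A" "nonderogatory P" "P \<in> reduced_centralizer A"
  shows "reduced_centralizer A = reduced_centralizer P"
proof
  have "A \<in> reduced_centralizer P" using assms by (simp add: reduced_centralizer_def nonderogatory_def)
  then show "reduced_centralizer P \<subseteq> reduced_centralizer A"
    by (rule reduced_centralizer_subset[OF assms(2,1)])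
qed (rule reduced_centralizer_subset[OF assms])

section \<open>Shortest centralizer elements and the count modulo scalars\<close>

definition ball_centralizer :: "nat \<Rightarrow> int ^ 3 ^ 3 \<Rightarrow> (int ^ 3 ^ 3) set" where
  "ball_centralizer M A = {B \<in> reduced_ball M. A ** B = B ** A}"

lemma finite_ball_centralizer: "finite (ball_centralizer M A)"
  unfolding ball_centralizer_def using finite_reduced_ball by auto

lemma card_ball_centralizer_le:
  assumes A: "nonderogatory A" and P: "P \<noteq> 0" "height P \<le> M"
    and min: "\<And>X. X \<in> reduced_centralizer A \<Longrightarrow> X \<noteq> 0 \<Longrightarrow> height P \<le> height X"
  shows "real (card (ball_centralizer M A)) \<le> (6 * real M / real (height P))\<^sup>2"
proof -
  let ?S = "entries ` reduced_centralizer A"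
  have "entries ` ball_centralizer M A = {x \<in> ?S. sup_abs x \<le> M}"
    by (auto simp: ball_centralizer_def reduced_centralizer_def reduced_ball_def)
  moreover have "card (entries ` ball_centralizer M A) = card (ball_centralizer M A)"
    using inj_entries inj_on_subset by (intro card_image) blast
  moreover have "real (card {x \<in> ?S. sup_abs x \<le> M}) \<le> (6 * real M / real (height P))\<^sup>2"
  proof (rule card_rank_le_2_ball_le)
    show "rank_le_2 ?S"
      unfolding rank_le_2_def
    proof (intro ballI)
      fix x y z assume "x \<in> ?S" "y \<in> ?S" "z \<in> ?S"
      then obtain X Y Z where XYZ: "X \<in> reduced_centralizer A" "Y \<in> reduced_centralizer A" "Z \<in> reduced_centralizer A"
        "x = entries X" "y = entries Y" "z = entries Z" by blast
      from nonderogatory_dependent3[OF A XYZ(1-3)]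
      show "\<exists>a b c. (a \<noteq> 0 \<or> b \<noteq> 0 \<or> c \<noteq> 0) \<and> (\<forall>i. a * x i + b * y i + c * z i = 0)"
        unfolding dependent3_def XYZ(4-6) entries_def split_paired_All by simp
    qed
    show "(\<lambda>i. x i - y i) \<in> ?S" if xy: "x \<in> ?S" "y \<in> ?S" for x y
    proof -
      obtain X Y where XY: "X \<in> reduced_centralizer A" "Y \<in> reduced_centralizer A" "x = entries X" "y = entries Y"
        using xy by blast
      have "X - Y \<in> reduced_centralizer A"
        using XY(1,2) by (simp add: reduced_centralizer_def vec_eq_iff matrix_matrix_mult_def
          left_diff_distrib right_diff_distrib sum_subtractf)
      moreover have "(\<lambda>i. x i - y i) = entries (X - Y)" by (auto simp: XY(3,4) entries_def)
      ultimately show ?thesis by blast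
    qed
    show "height P \<le> sup_abs x" if "x \<in> ?S" "x \<noteq> (\<lambda>_. 0)" for x
    proof -
      obtain X where X: "X \<in> reduced_centralizer A" "x = entries X" using \<open>x \<in> ?S\<close> by blast
      moreover have "X \<noteq> 0" using that(2) X(2) by (auto simp: entries_def)
      ultimately show ?thesis using min by simp
    qed
    show "0 < height P" using P(1) by (simp add: height_pos_iff)
    show "height P \<le> M" by (rule P(2))
  qed
  ultimately show ?thesis by simp
qed

text \<open>A minimal element is not unique (its negative is another), so one is fixed for each set;
  this choice later partitions the nonderogatory matrices into fibres.\<close>

definition shortest :: "(int ^ 3 ^ 3) set \<Rightarrow> int ^ 3 ^ 3" where
  "shortest L = arg_min height (\<lambda>X. X \<in> L \<and> X \<noteq> 0)"

lemma shortest: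
  assumes "X \<in> L" "X \<noteq> 0"
  shows "shortest L \<in> L" "shortest L \<noteq> 0" "height (shortest L) \<le> height X"
  using arg_min_natI[of "\<lambda>X. X \<in> L \<and> X \<noteq> 0" X height] arg_min_nat_le[of "\<lambda>X. X \<in> L \<and> X \<noteq> 0" X height] assms
  by (auto simp: shortest_def)

lemma derogatory_nonzero:
  fixes A :: "int ^ 3 ^ 3"
  assumes "derogatory A u v" "A $ 3 $ 3 = 0"
  shows "A \<noteq> 0"
proof -
  have "u \<noteq> 0" "v \<noteq> 0" using assms(1) primitive_nonzero by (auto simp: derogatory_def)
  then have "0 < vheight u * vheight v" by (simp add: vheight_pos_iff)
  then have "0 < height A" using vheight_mult_le_height[OF assms] by linarith
  then show ?thesis by (simp add: height_pos_iff)
qed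

text \<open>The sum is split into \<open>A = 0\<close>, derogatory \<open>A\<close> and
  nonderogatory \<open>A\<close>; the three constants 6561, 306110016 and 11065310208 add up to less
  than the one stated.\<close>

lemma sum_card_ball_centralizer_le:
  assumes M: "1 \<le> M"
  shows "(\<Sum>A\<in>reduced_ball M. real (card (ball_centralizer M A))) \<le> 12000000000 * real M ^ 8"
proof -
  define N where "N A = real (card (ball_centralizer M A))" for A
  define D where "D = {A \<in> reduced_ball M. \<exists>u v. derogatory A u v}"
  define G where "G = {A \<in> reduced_ball M. nonderogatory A}"
  define s where "s A = shortest (reduced_centralizer A)" for A
  have fin: "finite D" "finite G" using finite_reduced_ball by (auto simp: D_def G_def)
  have split: "reduced_ball M - {0} = G \<union> D" "G \<inter> D = {}"
    using derogatory_nonzero by (auto simp: D_def G_def nonderogatory_def reduced_ball_def)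
  have "(0 :: int ^ 3 ^ 3) \<in> reduced_ball M" by (simp add: reduced_ball_def height_le_iff)
  then have "(\<Sum>A\<in>reduced_ball M. N A) = N 0 + (\<Sum>A\<in>G. N A) + (\<Sum>A\<in>D. N A)"
    using sum.remove[OF finite_reduced_ball, of 0 M N] sum.union_disjoint[OF fin(2,1) split(2), of N]
    by (simp add: split(1))
  moreover have "N 0 \<le> 6561 * real M ^ 8"
  proof -
    have "N 0 \<le> real (card (reduced_ball M))"
      unfolding N_def by (intro of_nat_mono card_mono finite_reduced_ball) (auto simp: ball_centralizer_def)
    also have "\<dots> = (2 * real M + 1) ^ 8" by (simp add: card_reduced_ball add.commute)
    also have "\<dots> \<le> (3 * real M) ^ 8" using M by (intro power_mono) auto
    finally show ?thesis by (simp add: power_mult_distrib)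
  qed
  moreover have derN: "N A \<le> 6561 * real M ^ 4" if "A \<in> D" for A
  proof -
    have "card (ball_centralizer M A) \<le> (9 * M) ^ 4"
      using that card_centralizer_derogatory_le[OF _ M] by (auto simp: D_def ball_centralizer_def)
    then have "N A \<le> real ((9 * M) ^ 4)" unfolding N_def by (intro of_nat_mono)
    then show ?thesis by (simp add: power_mult_distrib)
  qed
  have sumD: "(\<Sum>A\<in>D. 1 / real (height A) ^ 2) \<le> 46656 * real M ^ 2"
    using sum_derogatory_le[of M] by (simp add: D_def)
  have "(\<Sum>A\<in>D. N A) \<le> 306110016 * real M ^ 8"
  proof -
    \<comment> \<open>The factor (M / height A)^2 is at least 1; inserting it turns the count of
      derogatory matrices into the weighted sum \<open>sumD\<close>.\<close>
    have "(\<Sum>A\<in>D. N A) \<le> (\<Sum>A\<in>D. 6561 * real M ^ 6 * (1 / real (height A) ^ 2))"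
    proof (rule sum_mono)
      fix A assume A: "A \<in> D"
      have "0 < height A" "height A \<le> M" using A split(1) by (auto simp: D_def reduced_ball_def height_pos_iff)
      then have "1 \<le> real M ^ 2 * (1 / real (height A) ^ 2)" by (simp add: field_simps)
      then have "6561 * real M ^ 4 * 1 \<le> 6561 * real M ^ 4 * (real M ^ 2 * (1 / real (height A) ^ 2))"
        by (intro mult_left_mono) auto
      also have "\<dots> = 6561 * real M ^ 6 * (1 / real (height A) ^ 2)" by (simp flip: power_add)
      finally show "N A \<le> 6561 * real M ^ 6 * (1 / real (height A) ^ 2)" using derN[OF A] by simp
    qed
    also have "\<dots> = 6561 * real M ^ 6 * (\<Sum>A\<in>D. 1 / real (height A) ^ 2)" by (simp only: sum_distrib_left)
    also have "\<dots> \<le> 6561 * real M ^ 6 * (46656 * real M ^ 2)" using sumD by (intro mult_left_mono) auto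
    also have "\<dots> = 306110016 * real M ^ 8" by (simp flip: power_add)
    finally show ?thesis .
  qed
  moreover have "(\<Sum>A\<in>G. N A) \<le> 11065310208 * real M ^ 8"
  proof -
    have s: "s A \<in> reduced_centralizer A" "s A \<noteq> 0" "s A \<in> reduced_ball M" 
      "\<And>X. X \<in> reduced_centralizer A \<Longrightarrow> X \<noteq> 0 \<Longrightarrow> height (s A) \<le> height X" if "A \<in> G" for A
    proof -
      have A: "A \<in> reduced_centralizer A" "A \<noteq> 0" "height A \<le> M"
        using that by (auto simp: G_def nonderogatory_def reduced_centralizer_def reduced_ball_def)
      note sh = shortest[OF A(1,2)]
      show "s A \<in> reduced_centralizer A" "s A \<noteq> 0" using sh by (auto simp: s_def)
      then show "s A \<in> reduced_ball M" using sh(3) A(3) by (auto simp: s_def reduced_centralizer_def reduced_ball_def)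
      show "height (s A) \<le> height X" if "X \<in> reduced_centralizer A" "X \<noteq> 0" for X
        using shortest(3)[OF that] by (simp add: s_def)
    qed
    have goodN: "N A \<le> (6 * real M / real (height (s A)))\<^sup>2" if "A \<in> G" for A
      unfolding N_def using that s[OF that]
      by (intro card_ball_centralizer_le) (auto simp: G_def reduced_ball_def)
    \<comment> \<open>Nonderogatory matrices are grouped by the shortest element \<open>P\<close> of
      their centralizer; \<open>P\<close> itself may be derogatory or not.\<close>
    define F where "F P = {A \<in> G. s A = P}" for P
    have "(\<Sum>A\<in>G. N A) \<le> (\<Sum>A\<in>G. (6 * real M / real (height (s A)))\<^sup>2)" by (rule sum_mono) (rule goodN)
    also have "\<dots> = (\<Sum>P\<in>reduced_ball M - {0}. \<Sum>A\<in>F P. (6 * real M / real (height (s A)))\<^sup>2)"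
      unfolding F_def using s finite_reduced_ball by (intro sum.group[symmetric] fin) auto
    also have "\<dots> = (\<Sum>P\<in>reduced_ball M - {0}. real (card (F P)) * (6 * real M / real (height P))\<^sup>2)"
      by (intro sum.cong) (auto simp: F_def)
    also have "\<dots> = (\<Sum>P\<in>G. real (card (F P)) * (6 * real M / real (height P))\<^sup>2)
        + (\<Sum>P\<in>D. real (card (F P)) * (6 * real M / real (height P))\<^sup>2)"
      unfolding split(1) by (intro sum.union_disjoint fin split)
    also have "(\<Sum>P\<in>G. real (card (F P)) * (6 * real M / real (height P))\<^sup>2)
        \<le> (\<Sum>P\<in>G. 1296 * real M ^ 4 * (1 / real (height P) ^ 4))"
    proof (rule sum_mono)
      fix P assume P: "P \<in> G"
      \<comment> \<open>Every \<open>A\<close> in the fibre commutes with \<open>P\<close>. If the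
        fibre is nonempty, \<open>P\<close> is also shortest in its own centralizer, so the packing
        bound applies to \<open>P\<close> and bounds the fibre too.\<close>
      have "real (card (F P)) \<le> (6 * real M / real (height P))\<^sup>2"
      proof (cases "F P = {}")
        case False
        then obtain A where A: "A \<in> G" "s A = P" by (auto simp: F_def)
        have sub: "F P \<subseteq> ball_centralizer M P"
          using s(1) by (auto simp: F_def G_def ball_centralizer_def reduced_centralizer_def)
        have eq: "reduced_centralizer A = reduced_centralizer P"
          using s(1)[OF A(1)] A P by (intro reduced_centralizer_eq) (auto simp: G_def)
        have "real (card (F P)) \<le> real (card (ball_centralizer M P))"
          by (intro of_nat_mono card_mono finite_ball_centralizer sub)
        also have "\<dots> \<le> (6 * real M / real (height P))\<^sup>2"
          using s[OF A(1)] A P by (intro card_ball_centralizer_le) (auto simp: eq G_def reduced_ball_def)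
        finally show ?thesis .
      qed simp
      then have "real (card (F P)) * (6 * real M / real (height P))\<^sup>2
         \<le> (6 * real M / real (height P))\<^sup>2 * (6 * real M / real (height P))\<^sup>2"
        by (intro mult_right_mono) auto
      also have "\<dots> = (6 * real M / real (height P)) ^ 4" by (simp flip: power_add)
      also have "\<dots> = 1296 * real M ^ 4 * (1 / real (height P) ^ 4)" by (simp add: power_divide power_mult_distrib)
      finally show "real (card (F P)) * (6 * real M / real (height P))\<^sup>2 \<le> 1296 * real M ^ 4 * (1 / real (height P) ^ 4)" .
    qed
    also have "(\<Sum>P\<in>G. 1296 * real M ^ 4 * (1 / real (height P) ^ 4)) = 1296 * real M ^ 4 * (\<Sum>P\<in>G. 1 / real (height P) ^ 4)"
      by (simp only: sum_distrib_left)
    also have "\<dots> \<le> 1296 * real M ^ 4 * (34992 * real M ^ 4)"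
    proof (rule mult_left_mono)
      have "(\<Sum>P\<in>G. 1 / real (height P) ^ 4) \<le> (\<Sum>P\<in>reduced_ball M - {0}. 1 / real (height P) ^ 4)"
        unfolding split(1) using fin by (intro sum_mono2) auto
      then show "(\<Sum>P\<in>G. 1 / real (height P) ^ 4) \<le> 34992 * real M ^ 4"
        using sum_inverse_height_power4_le[of M] by linarith
    qed simp
    \<comment> \<open>For derogatory \<open>P\<close> the fibre is bounded by the weaker
      \<open>derN\<close>; the constant is 6561 * 36.\<close>
    also have "(\<Sum>P\<in>D. real (card (F P)) * (6 * real M / real (height P))\<^sup>2)
        \<le> (\<Sum>P\<in>D. 236196 * real M ^ 6 * (1 / real (height P) ^ 2))"
    proof (rule sum_mono)
      fix P assume P: "P \<in> D"
      have "F P \<subseteq> ball_centralizer M P"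
        using s(1) by (auto simp: F_def G_def ball_centralizer_def reduced_centralizer_def)
      then have "real (card (F P)) \<le> N P"
        unfolding N_def by (intro of_nat_mono card_mono finite_ball_centralizer)
      then have "real (card (F P)) \<le> 6561 * real M ^ 4" using derN[OF P] by simp
      then have "real (card (F P)) * (6 * real M / real (height P))\<^sup>2 \<le> 6561 * real M ^ 4 * (6 * real M / real (height P))\<^sup>2"
        by (intro mult_right_mono) auto
      also have "\<dots> = 236196 * real M ^ 6 * (1 / real (height P) ^ 2)"
        by (simp add: power_divide power_mult_distrib flip: power_add)
      finally show "real (card (F P)) * (6 * real M / real (height P))\<^sup>2 \<le> 236196 * real M ^ 6 * (1 / real (height P) ^ 2)" .
    qed
    also have "\<dots> = 236196 * real M ^ 6 * (\<Sum>P\<in>D. 1 / real (height P) ^ 2)" by (simp only: sum_distrib_left)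
    also have "\<dots> \<le> 236196 * real M ^ 6 * (46656 * real M ^ 2)" using sumD by (intro mult_left_mono) auto
    also have "1296 * real M ^ 4 * (34992 * real M ^ 4) + 236196 * real M ^ 6 * (46656 * real M ^ 2) = 11065310208 * real M ^ 8"
      by (simp flip: power_add)
    finally show ?thesis by simp
  qed
  moreover have "0 \<le> real M ^ 8" by simp
  ultimately show ?thesis unfolding N_def by linarith
qed

section \<open>Passage between all matrices and representatives modulo scalars\<close>

lemma commute_minus_mat:
  fixes A B :: "int ^ 'n ^ 'n"
  assumes "A ** B = B ** A"
  shows "(A - mat a) ** (B - mat b) = (B - mat b) ** (A - mat a)"
proof -
  have l: "(X - mat c) ** Y = X ** Y - (\<chi> i j. c * Y $ i $ j)" for X Y :: "int ^ 'n ^ 'n" and c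
  proof -
    have "(\<Sum>k\<in>UNIV. (X $ i $ k - mat c $ i $ k) * Y $ k $ j) = (\<Sum>k\<in>UNIV. X $ i $ k * Y $ k $ j) - c * Y $ i $ j" for i j
    proof -
      have "(\<Sum>k\<in>UNIV. (X $ i $ k - mat c $ i $ k) * Y $ k $ j)
          = (\<Sum>k\<in>UNIV. X $ i $ k * Y $ k $ j - (if k = i then c * Y $ i $ j else 0))"
        by (intro sum.cong) (auto simp: mat_def left_diff_distrib)
      then show ?thesis by (simp add: sum_subtractf)
    qed
    then show ?thesis by (simp add: vec_eq_iff matrix_matrix_mult_def)
  qed
  have r: "Y ** (X - mat c) = Y ** X - (\<chi> i j. c * Y $ i $ j)" for X Y :: "int ^ 'n ^ 'n" and c
  proof -
    have "(\<Sum>k\<in>UNIV. Y $ i $ k * (X $ k $ j - mat c $ k $ j)) = (\<Sum>k\<in>UNIV. Y $ i $ k * X $ k $ j) - c * Y $ i $ j" for i j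
    proof -
      have "(\<Sum>k\<in>UNIV. Y $ i $ k * (X $ k $ j - mat c $ k $ j))
          = (\<Sum>k\<in>UNIV. Y $ i $ k * X $ k $ j - (if k = j then c * Y $ i $ j else 0))"
        by (intro sum.cong) (auto simp: mat_def right_diff_distrib)
      then show ?thesis by (simp add: sum_subtractf)
    qed
    then show ?thesis by (simp add: vec_eq_iff matrix_matrix_mult_def)
  qed
  show ?thesis unfolding l r assms by (auto simp: vec_eq_iff mat_def algebra_simps)
qed

lemma bounded_int_mats_iff: "A \<in> bounded_int_mats N \<longleftrightarrow> height A \<le> N"
  by (simp add: bounded_int_mats_def height_le_iff)

lemma finite_bounded_int_mats: "finite (bounded_int_mats N :: (int ^ 'n ^ 'n) set)"
  and card_bounded_int_mats: "card (bounded_int_mats N :: (int ^ 'n ^ 'n) set) = (2 * N + 1) ^ (CARD('n) * CARD('n))"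
proof -
  let ?S = "bounded_int_mats N :: (int ^ 'n ^ 'n) set"
  have inj: "inj_on entries ?S" using inj_entries inj_on_subset by blast
  have "x \<in> entries ` ?S" if "sup_abs x \<le> N" for x
  proof (rule image_eqI)
    show e: "x = entries (\<chi> i j. x (i, j))" by (auto simp: entries_def)
    show "(\<chi> i j. x (i, j)) \<in> ?S" using that unfolding bounded_int_mats_iff e[symmetric] .
  qed
  then have im: "entries ` ?S = {x. (\<forall>i. i \<notin> UNIV \<longrightarrow> x i = 0) \<and> sup_abs x \<le> N}"
    by (auto simp: bounded_int_mats_iff)
  show "finite ?S" using finite_imageD[OF _ inj] sup_abs_ball(1)[of UNIV N] by (simp only: im)
  show "card ?S = (2 * N + 1) ^ (CARD('n) * CARD('n))"
    using card_image[OF inj] sup_abs_ball(2)[of "UNIV :: ('n \<times> 'n) set" N] unfolding im by simp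
qed

lemma commuting_count_ge: "real N ^ 10 \<le> real (commuting_count N TYPE(3))"
proof -
  let ?S = "{(A, B). A \<in> (bounded_int_mats N :: (int ^ 3 ^ 3) set) \<and> B \<in> bounded_int_mats N \<and> A ** B = B ** A}"
  let ?T = "(bounded_int_mats N :: (int ^ 3 ^ 3) set) \<times> {- int N..int N}"
  have comm: "A ** mat c = mat c ** A" for A :: "int ^ 3 ^ 3" and c
    by (simp add: vec_eq_iff matrix_matrix_mult_def mat_def if_distrib[of "\<lambda>x. x * _"] if_distrib[of "\<lambda>x. _ * x"] mult.commute cong: if_cong)
  have mat_inj: "c = d" if "mat c = (mat d :: int ^ 3 ^ 3)" for c d
    using arg_cong[OF that, of "\<lambda>A. A $ 3 $ 3"] by (simp add: mat_def)
  have mat_bounded: "(mat c :: int ^ 3 ^ 3) \<in> bounded_int_mats N" if "- int N \<le> c" "c \<le> int N" for c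
    using that by (auto simp: bounded_int_mats_def mat_def abs_le_iff)
  define g where "g = (\<lambda>(A :: int ^ 3 ^ 3, c). (A, mat c :: int ^ 3 ^ 3))"
  have "card ?T \<le> card ?S"
  proof (rule card_inj_on_le[of g])
    show "inj_on g ?T"
      by (auto simp: g_def intro!: inj_onI dest: mat_inj)
    show "g ` ?T \<subseteq> ?S"
      by (auto simp: g_def comm mat_bounded)
    show "finite ?S"
      by (rule finite_subset[OF _ finite_cartesian_product[OF finite_bounded_int_mats finite_bounded_int_mats]]) auto
  qed
  \<comment> \<open>Nine free entries of \<open>A\<close> and one free scalar.\<close>
  moreover have "card ?T = (2 * N + 1) ^ 10"
    by (simp add: card_cartesian_product card_bounded_int_mats nat_add_distrib nat_mult_distrib eval_nat_numeral)
  moreover have "N ^ 10 \<le> (2 * N + 1) ^ 10" by (intro power_mono) auto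
  ultimately have "N ^ 10 \<le> commuting_count N TYPE(3)" unfolding commuting_count_def by linarith
  then show ?thesis by (metis of_nat_le_iff of_nat_power)
qed

text \<open>Subtracting the scalar matrix of the (3, 3) entry at most doubles the height, whence the
  radius \<open>2 * N\<close>; the two scalars contribute at most 9 N^2. The constant is 9 * 2^8 *
  12000000000.\<close>

lemma commuting_count_le:
  assumes N: "1 \<le> N"
  shows "real (commuting_count N TYPE(3)) \<le> 27648000000000 * real N ^ 10"
proof -
  let ?S = "{(A, B). A \<in> (bounded_int_mats N :: (int ^ 3 ^ 3) set) \<and> B \<in> bounded_int_mats N \<and> A ** B = B ** A}"
  define Q where "Q = Sigma (reduced_ball (2 * N)) (ball_centralizer (2 * N))"
  define I where "I = {- int N..int N}"
  define r where "r A = A - mat (A $ 3 $ 3)" for A :: "int ^ 3 ^ 3"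
  define f where "f = (\<lambda>(A, B). ((A $ 3 $ 3, B $ 3 $ 3), (r A, r B)))"
  have r: "r A \<in> reduced_ball (2 * N)" if "A \<in> bounded_int_mats N" for A
  proof -
    have A: "\<bar>A $ i $ j\<bar> \<le> int N" for i j using that by (simp add: bounded_int_mats_def)
    have "\<bar>A $ i $ j - mat (A $ 3 $ 3) $ i $ j\<bar> \<le> 2 * int N" for i j
      using A[of i j] A[of 3 3] abs_triangle_ineq4[of "A $ i $ j" "A $ 3 $ 3"] by (auto simp: mat_def)
    then show ?thesis by (simp add: reduced_ball_def height_le_iff r_def mat_def)
  qed
  have finQ: "finite Q" unfolding Q_def by (intro finite_SigmaI finite_reduced_ball finite_ball_centralizer)
  have "card ?S \<le> card ((I \<times> I) \<times> Q)"
  proof (rule card_inj_on_le[of f])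
    show "inj_on f ?S"
      by (rule inj_onI) (auto simp: f_def r_def)
    show "f ` ?S \<subseteq> (I \<times> I) \<times> Q"
    proof (rule image_subsetI)
      fix p assume "p \<in> ?S"
      then obtain A B where p: "p = (A, B)" "A \<in> bounded_int_mats N" "B \<in> bounded_int_mats N" "A ** B = B ** A"
        by auto
      have "A $ 3 $ 3 \<in> I" "B $ 3 $ 3 \<in> I" using p(2,3) by (simp_all add: I_def bounded_int_mats_def abs_le_iff minus_le_iff)
      moreover have "r A ** r B = r B ** r A" unfolding r_def by (rule commute_minus_mat) fact
      ultimately show "f p \<in> (I \<times> I) \<times> Q" using r p by (simp add: f_def Q_def ball_centralizer_def)
    qed
    show "finite ((I \<times> I) \<times> Q)" using finQ by (simp add: I_def)
  qed
  then have "real (commuting_count N TYPE(3)) \<le> real (card ((I \<times> I) \<times> Q))"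
    unfolding commuting_count_def by (rule of_nat_mono)
  also have "\<dots> = (2 * real N + 1) ^ 2 * real (card Q)"
    by (simp add: card_cartesian_product I_def nat_add_distrib nat_mult_distrib power2_eq_square algebra_simps)
  also have "\<dots> \<le> (3 * real N) ^ 2 * (12000000000 * real (2 * N) ^ 8)"
  proof (rule mult_mono)
    show "(2 * real N + 1) ^ 2 \<le> (3 * real N) ^ 2" using N by (intro power_mono) auto
    have "real (card Q) = (\<Sum>A\<in>reduced_ball (2 * N). real (card (ball_centralizer (2 * N) A)))"
      unfolding Q_def using finite_reduced_ball finite_ball_centralizer by (simp add: card_SigmaI)
    also have "\<dots> \<le> 12000000000 * real (2 * N) ^ 8" using N by (intro sum_card_ball_centralizer_le) simp
    finally show "real (card Q) \<le> 12000000000 * real (2 * N) ^ 8" .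
  qed auto
  also have "\<dots> = 27648000000000 * real N ^ 10" by (simp add: power_mult_distrib flip: power_add)
  finally show ?thesis .
qed

theorem theorem1p1:
  shows "\<exists>c C :: real. c > 0 \<and> C > 0 \<and>
    (\<forall>N :: nat. N \<ge> 1 \<longrightarrow>
       c * real N ^ 10 \<le> real (commuting_count N TYPE(3)) \<and>
       real (commuting_count N TYPE(3)) \<le> C * real N ^ 10)"
  using commuting_count_ge commuting_count_le
  by (intro exI[of _ 1] exI[of _ 27648000000000]) auto

end
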